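(* Let $\mathcal{G}$ and $\mathcal{H}$ be metric graphs, with $\mathcal{G}$ not isomorphic to a circle graph. Suppose there exists a continuous map $\phi:G\to H$ with $\phi_\#\mu_G=\mu_H$ such that $h_{\mathcal{G}}(x,r)=h_{\mathcal{H}}(\phi(x),r)$ for all $x\in G$ and $r\geq0$. Then $\phi$ is an isomorphism of mm-spaces (a measure-preserving isometry).
   Context: A metric graph is a connected compact metric space $(G,d_G)$ isometric to the geometric realization of a finite one-dimensional simplicial complex with its geodesic (path-length) metric; it is regarded as the mm-space $\mathcal{G}=(G,d_G,\mu_G)$ with $\mu_G$ the uniform probability measure (one-dimensional length measure normalized to total mass one). A circle graph is a metric graph isomorphic to a circle with its intrinsic arclength distance and normalized uniform measure. The local distance distribution is $h_{\mathcal{G}}(x,r)=\mu_G(\{x'\in G: d_G(x,x')\le r\})$. *)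

theory Defs
  imports "HOL-Analysis.Analysis"
begin

text \<open>A metric graph is encoded by a set G with a distance d and a finite nonempty family of
  edges: edge i (i in the finite index set I) has length l i > 0 and is parametrised by
  gam i on the closed interval from 0 to l i.  The edges cover G, each parametrisation is
  injective, open edges are disjoint from all other closed edges, distinct edges have
  distinct endpoint pairs (simplicial complex), and d is the geodesic (path-length) metric
  of the geometric realisation, i.e. the infimum of the lengths of edge chains.\<close>

definition edge_step ::
  "nat set \<Rightarrow> (nat \<Rightarrow> real) \<Rightarrow> (nat \<Rightarrow> real \<Rightarrow> 'a) \<Rightarrow> 'a \<Rightarrow> 'a \<Rightarrow> real set" where
  "edge_step I l gam x y =
     {\<bar>s - t\<bar> | i s t. i \<in> I \<and> s \<in> {0..l i} \<and> t \<in> {0..l i} \<and> gam i s = x \<and> gam i t = y}"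

definition chain_lengths ::
  "nat set \<Rightarrow> (nat \<Rightarrow> real) \<Rightarrow> (nat \<Rightarrow> real \<Rightarrow> 'a) \<Rightarrow> 'a \<Rightarrow> 'a \<Rightarrow> real set" where
  "chain_lengths I l gam x y =
     {(\<Sum>k<n. c k) | n p c. p 0 = x \<and> p n = y \<and>
        (\<forall>k<n. c k \<in> edge_step I l gam (p k) (p (Suc k)))}"

definition metric_graph ::
  "'a set \<Rightarrow> ('a \<Rightarrow> 'a \<Rightarrow> real) \<Rightarrow> nat set \<Rightarrow> (nat \<Rightarrow> real) \<Rightarrow> (nat \<Rightarrow> real \<Rightarrow> 'a) \<Rightarrow> bool" where
  "metric_graph G d I l gam \<longleftrightarrow>
     finite I \<and> I \<noteq> {} \<and>
     (\<forall>i\<in>I. l i > 0) \<and>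
     G = (\<Union>i\<in>I. gam i ` {0..l i}) \<and>
     (\<forall>i\<in>I. inj_on (gam i) {0..l i}) \<and>
     (\<forall>i\<in>I. \<forall>j\<in>I. i \<noteq> j \<longrightarrow> gam i ` {0<..<l i} \<inter> gam j ` {0..l j} = {}) \<and>
     (\<forall>i\<in>I. \<forall>j\<in>I. i \<noteq> j \<longrightarrow> {gam i 0, gam i (l i)} \<noteq> {gam j 0, gam j (l j)}) \<and>
     (\<forall>x\<in>G. \<forall>y\<in>G. chain_lengths I l gam x y \<noteq> {} \<and> d x y = Inf (chain_lengths I l gam x y)) \<and>
     Metric_space G d"

definition borel_sets :: "'a set \<Rightarrow> ('a \<Rightarrow> 'a \<Rightarrow> real) \<Rightarrow> 'a set set" where
  "borel_sets G d = sigma_sets G {U. openin (Metric_space.mtopology G d) U}"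

definition graph_measure ::
  "nat set \<Rightarrow> (nat \<Rightarrow> real) \<Rightarrow> (nat \<Rightarrow> real \<Rightarrow> 'a) \<Rightarrow> 'a set \<Rightarrow> real" where
  "graph_measure I l gam A =
     (\<Sum>i\<in>I. measure lborel ({0..l i} \<inter> gam i -` A)) / (\<Sum>i\<in>I. l i)"

definition local_dist ::
  "'a set \<Rightarrow> ('a \<Rightarrow> 'a \<Rightarrow> real) \<Rightarrow> nat set \<Rightarrow> (nat \<Rightarrow> real) \<Rightarrow> (nat \<Rightarrow> real \<Rightarrow> 'a) \<Rightarrow> 'a \<Rightarrow> real \<Rightarrow> real" where
  "local_dist G d I l gam x r = graph_measure I l gam {x' \<in> G. d x x' \<le> r}"

text \<open>mm-isomorphism with a circle of circumference c (intrinsic arclength metric,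
  normalised uniform measure), the circle being modelled on [0,c).\<close>
definition circle_graph ::
  "'a set \<Rightarrow> ('a \<Rightarrow> 'a \<Rightarrow> real) \<Rightarrow> nat set \<Rightarrow> (nat \<Rightarrow> real) \<Rightarrow> (nat \<Rightarrow> real \<Rightarrow> 'a) \<Rightarrow> bool" where
  "circle_graph G d I l gam \<longleftrightarrow>
     (\<exists>c>0. \<exists>f. bij_betw f G {0..<c} \<and>
        (\<forall>x\<in>G. \<forall>y\<in>G. d x y = min \<bar>f x - f y\<bar> (c - \<bar>f x - f y\<bar>)) \<and>
        (\<forall>A \<in> sets borel. A \<subseteq> {0..<c} \<longrightarrow>
            graph_measure I l gam (G \<inter> f -` A) = measure lborel A / c))"

end

theory Submission
  imports Defs
begin

text \<open>
  Merge edges at vertices of valence 2 until a non-circle graph has none left, and let the tent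
  function of a point be its distance along its edge to the nearer end. The ball of radius r
  around a point x of a graph of total length L has measure 2r/L exactly up to r equal to the tent
  of x, unless x is the midpoint of its edge: beyond that radius the growth rate becomes the
  valence of the end reached, which is not 2. So the local distance distribution determines the
  tent function, first off a null set and then everywhere by continuity, i.e. the map carries one
  tent function to the other. Around every point of the target the distance to that point is the
  change of the tent function, and tent functions are 1-Lipschitz, hence the map is locally, and
  then globally, 1-Lipschitz. Finally, a measure-preserving 1-Lipschitz map that preserves the
  measures of balls is isometric: if it shrank the distance of x and y, the preimage of a suitable
  ball around the image of x would contain, besides the ball of the same radius around x, a
  neighbourhood of y of positive measure.
\<close>

section \<open>Graphs with loops and multiple edges\<close>

definition edge_preim :: "(nat \<Rightarrow> real) \<Rightarrow> (nat \<Rightarrow> real \<Rightarrow> 'a) \<Rightarrow> 'a set \<Rightarrow> nat \<Rightarrow> real set" where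
  "edge_preim l gam A i = {0..l i} \<inter> gam i -` A"

definition edge_meas :: "nat set \<Rightarrow> (nat \<Rightarrow> real) \<Rightarrow> (nat \<Rightarrow> real \<Rightarrow> 'a) \<Rightarrow> 'a set \<Rightarrow> bool" where
  "edge_meas I l gam A \<longleftrightarrow> (\<forall>i\<in>I. edge_preim l gam A i \<in> sets borel)"

text \<open>\<open>measure\<close> is 0 outside the measurable sets, so fusing an edge on which A is
  nonmeasurable with one on which it is measurable may change \<open>graph_measure\<close>. Hence
  values are compared on measurable sets only, and measurability has to be transferred as
  well.\<close>

definition same_measure ::
  "nat set \<Rightarrow> (nat \<Rightarrow> real) \<Rightarrow> (nat \<Rightarrow> real \<Rightarrow> 'a) \<Rightarrow> nat set \<Rightarrow> (nat \<Rightarrow> real) \<Rightarrow> (nat \<Rightarrow> real \<Rightarrow> 'a) \<Rightarrow> bool" where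
  "same_measure I l gam I' l' gam' \<longleftrightarrow> (\<forall>A. (edge_meas I' l' gam' A \<longleftrightarrow> edge_meas I l gam A) \<and>
     (edge_meas I l gam A \<longrightarrow> graph_measure I' l' gam' A = graph_measure I l gam A))"

text \<open>Loops and multiple edges arise when edges are merged. That d is the path metric is expressed
  by the universal property of being the largest function satisfying the triangle inequality and
  bounded by arc length on each edge; this form survives merging with no computation.\<close>

locale mgraph = Metric_space G d for G :: "'a set" and d :: "'a \<Rightarrow> 'a \<Rightarrow> real" +
  fixes I :: "nat set" and l :: "nat \<Rightarrow> real" and gam :: "nat \<Rightarrow> real \<Rightarrow> 'a"
  assumes finite_edges: "finite I" and edges_nonempty: "I \<noteq> {}"
    and len_pos: "\<And>i. i \<in> I \<Longrightarrow> 0 < l i"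
    and cover: "G = (\<Union>i\<in>I. gam i ` {0..l i})"
    and sep: "\<And>i j s t. \<lbrakk>i \<in> I; j \<in> I; 0 < s; s < l i; 0 \<le> t; t \<le> l j; gam i s = gam j t\<rbrakk>
      \<Longrightarrow> i = j \<and> s = t"
    and edge_le: "\<And>i s t. \<lbrakk>i \<in> I; 0 \<le> s; s \<le> l i; 0 \<le> t; t \<le> l i\<rbrakk>
      \<Longrightarrow> d (gam i s) (gam i t) \<le> \<bar>s - t\<bar>"
    and universal: "\<And>e x y. \<lbrakk>\<And>z. z \<in> G \<Longrightarrow> e z z \<le> 0;
        \<And>z w v. \<lbrakk>z \<in> G; w \<in> G; v \<in> G\<rbrakk> \<Longrightarrow> e z v \<le> e z w + e w v;
        \<And>i s t. \<lbrakk>i \<in> I; 0 \<le> s; s \<le> l i; 0 \<le> t; t \<le> l i\<rbrakk> \<Longrightarrow> e (gam i s) (gam i t) \<le> \<bar>s - t\<bar>;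
        x \<in> G; y \<in> G\<rbrakk> \<Longrightarrow> e x y \<le> d x y"
begin

abbreviation gm :: "'a set \<Rightarrow> real" where "gm \<equiv> graph_measure I l gam"

abbreviation preim :: "'a set \<Rightarrow> nat \<Rightarrow> real set" where "preim \<equiv> edge_preim l gam"

abbreviation meas :: "'a set \<Rightarrow> bool" where "meas \<equiv> edge_meas I l gam"

definition total :: real where "total = (\<Sum>i\<in>I. l i)"

text \<open>A loop counts twice, which makes \<open>valence\<close> the growth rate of small balls
  around a vertex.\<close>

definition ends_at :: "'a \<Rightarrow> nat \<Rightarrow> nat" where
  "ends_at p i = (if gam i 0 = p then 1 else 0) + (if gam i (l i) = p then 1 else 0)"

definition valence :: "'a \<Rightarrow> nat" where "valence p = (\<Sum>i\<in>I. ends_at p i)"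

definition vertices :: "'a set" where "vertices = (\<Union>i\<in>I. {gam i 0, gam i (l i)})"

text \<open>Below this radius the pieces that a ball around a vertex cuts from the two ends of one
  edge stay disjoint, even on a loop.\<close>

definition half_min_len :: real where "half_min_len = Min (l ` I) / 2"

text \<open>Meaningful only if g takes equal values at all parameters of the same point.\<close>

definition lift :: "(nat \<Rightarrow> real \<Rightarrow> real) \<Rightarrow> 'a \<Rightarrow> real" where
  "lift g y = (case SOME p. fst p \<in> I \<and> 0 \<le> snd p \<and> snd p \<le> l (fst p) \<and> gam (fst p) (snd p) = y
     of (i, t) \<Rightarrow> g i t)"

definition tent :: "'a \<Rightarrow> real" where "tent = lift (\<lambda>i t. min t (l i - t))"

section \<open>Points, vertices and edge parameters\<close>

lemma total_pos: "0 < total"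
  unfolding total_def using finite_edges edges_nonempty len_pos by (simp add: sum_pos)

lemma half_min_len_pos: "0 < half_min_len"
  unfolding half_min_len_def using finite_edges edges_nonempty len_pos by auto

lemma half_min_len_le: "i \<in> I \<Longrightarrow> 2 * half_min_len \<le> l i"
  unfolding half_min_len_def using finite_edges by auto

lemma gam_in [intro]: "\<lbrakk>i \<in> I; 0 \<le> t; t \<le> l i\<rbrakk> \<Longrightarrow> gam i t \<in> G"
  by (subst cover, rule UN_I) auto

lemma in_G_E:
  assumes "x \<in> G"
  obtains i t where "i \<in> I" "0 \<le> t" "t \<le> l i" "x = gam i t"
  using assms cover by auto

lemma finite_vertices: "finite vertices"
  unfolding vertices_def using finite_edges by auto

lemma vertex_ends [intro]: "i \<in> I \<Longrightarrow> gam i 0 \<in> vertices" "i \<in> I \<Longrightarrow> gam i (l i) \<in> vertices"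
  unfolding vertices_def by auto

lemma vertices_sub: "vertices \<subseteq> G"
proof
  fix x assume "x \<in> vertices"
  then obtain i where i: "i \<in> I" "x = gam i 0 \<or> x = gam i (l i)" unfolding vertices_def by blast
  then show "x \<in> G" using gam_in[of i 0] gam_in[of i "l i"] len_pos[of i] by auto
qed

lemma vertices_nonempty: "vertices \<noteq> {}"
  using edges_nonempty vertex_ends by blast

lemma interior_not_vertex:
  assumes "i \<in> I" "0 < s" "s < l i" shows "gam i s \<notin> vertices"
proof
  assume "gam i s \<in> vertices"
  then obtain j where j: "j \<in> I" "gam i s = gam j 0 \<or> gam i s = gam j (l j)"
    unfolding vertices_def by auto
  with sep[OF assms(1) j(1) assms(2,3), of 0] sep[OF assms(1) j(1) assms(2,3), of "l j"] len_pos[of j] assms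
  show False by auto
qed

lemma not_vertex_E:
  assumes "x \<in> G" "x \<notin> vertices"
  obtains i t where "i \<in> I" "0 < t" "t < l i" "x = gam i t"
proof -
  obtain i t where it: "i \<in> I" "0 \<le> t" "t \<le> l i" "x = gam i t" using assms(1) by (rule in_G_E)
  then have "t \<noteq> 0" "t \<noteq> l i" using assms(2) vertex_ends by auto
  then show thesis by (intro that[of i t]) (use it in auto)
qed

lemma vertex_param:
  assumes "i \<in> I" "0 \<le> s" "s \<le> l i" "gam i s \<in> vertices" shows "s = 0 \<or> s = l i"
  using interior_not_vertex[of i s] assms by force

section \<open>Functions given edge by edge\<close>

lemma param_cases:
  assumes "i \<in> I" "j \<in> I" "0 \<le> s" "s \<le> l i" "0 \<le> t" "t \<le> l j" "gam i s = gam j t"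
  shows "(i = j \<and> s = t) \<or> ((s = 0 \<or> s = l i) \<and> (t = 0 \<or> t = l j))"
  using sep[of i j s t] sep[of j i t s] assms by force

text \<open>\<open>W\<close> prescribes the values at the vertices. By \<open>param_cases\<close>
  two parameters of one point either agree or are both ends of edges, where \<open>g\<close> equals
  \<open>W\<close> of that point.\<close>

lemma consistentI:
  assumes "\<And>i. i \<in> I \<Longrightarrow> g i 0 = W (gam i 0)" "\<And>i. i \<in> I \<Longrightarrow> g i (l i) = W (gam i (l i))"
    and "i \<in> I" "j \<in> I" "0 \<le> s" "s \<le> l i" "0 \<le> t" "t \<le> l j" "gam i s = gam j t"
  shows "g i s = g j t"
  using param_cases[OF assms(3-9)] assms by metis

lemma lift_eq:
  fixes g :: "nat \<Rightarrow> real \<Rightarrow> real"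
  assumes "\<And>i. i \<in> I \<Longrightarrow> g i 0 = W (gam i 0)" "\<And>i. i \<in> I \<Longrightarrow> g i (l i) = W (gam i (l i))"
    and "i \<in> I" "0 \<le> s" "s \<le> l i"
  shows "lift g (gam i s) = g i s"
proof -
  let ?P = "\<lambda>p. fst p \<in> I \<and> 0 \<le> snd p \<and> snd p \<le> l (fst p) \<and> gam (fst p) (snd p) = gam i s"
  have P: "?P (SOME p. ?P p)" by (rule someI[of ?P "(i, s)"]) (use assms in auto)
  define q where "q = (SOME p. ?P p)"
  have q: "fst q \<in> I" "0 \<le> snd q" "snd q \<le> l (fst q)" "gam (fst q) (snd q) = gam i s"
    using P unfolding q_def by blast+
  have "g (fst q) (snd q) = g i s"
    by (rule consistentI[where W = W, OF assms(1,2) q(1) assms(3) q(2,3) assms(4,5) q(4)])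
  then show ?thesis unfolding lift_def q_def by (simp add: case_prod_beta)
qed

text \<open>The increments of a function satisfy the triangle inequality with equality, so
  \<open>universal\<close> applies to them and turns Lipschitz bounds along edges into Lipschitz
  bounds for \<open>d\<close>. The lower bounds on distances in this section all come from
  here.\<close>

lemma lipschitz_le:
  assumes g: "\<And>i. i \<in> I \<Longrightarrow> g i 0 = W (gam i 0)" "\<And>i. i \<in> I \<Longrightarrow> g i (l i) = W (gam i (l i))"
    and lip: "\<And>i s t. \<lbrakk>i \<in> I; 0 \<le> s; s \<le> l i; 0 \<le> t; t \<le> l i\<rbrakk> \<Longrightarrow> g i t - g i s \<le> \<bar>s - t\<bar>"
    and st: "i \<in> I" "j \<in> I" "0 \<le> s" "s \<le> l i" "0 \<le> t" "t \<le> l j"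
  shows "g j t - g i s \<le> d (gam i s) (gam j t)"
proof -
  have L: "lift g (gam k r) = g k r" if "k \<in> I" "0 \<le> r" "r \<le> l k" for k r
    by (rule lift_eq[where W = W]) (use g that in auto)
  have "lift g (gam j t) - lift g (gam i s) \<le> d (gam i s) (gam j t)"
    by (rule universal[where e = "\<lambda>x y. lift g y - lift g x"]) (use L lip st gam_in in auto)
  then show ?thesis using L st by simp
qed

section \<open>The tent function, lower bounds on distances, and balls\<close>

lemma tent_eq: "\<lbrakk>i \<in> I; 0 \<le> s; s \<le> l i\<rbrakk> \<Longrightarrow> tent (gam i s) = min s (l i - s)"
  unfolding tent_def by (rule lift_eq[where W = "\<lambda>_. 0"]) (auto dest: len_pos)

lemma tent_lipschitz:
  assumes "x \<in> G" "y \<in> G" shows "\<bar>tent x - tent y\<bar> \<le> d x y"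
proof -
  have *: "tent y - tent x \<le> d x y" if xy: "x \<in> G" "y \<in> G" for x y
  proof -
    obtain i s where i: "i \<in> I" "0 \<le> s" "s \<le> l i" "x = gam i s" using xy(1) by (rule in_G_E)
    obtain j t where j: "j \<in> I" "0 \<le> t" "t \<le> l j" "y = gam j t" using xy(2) by (rule in_G_E)
    have "min t (l j - t) - min s (l i - s) \<le> d (gam i s) (gam j t)"
      by (rule lipschitz_le[where W = "\<lambda>_. 0"]) (use i j in \<open>auto dest: len_pos\<close>)
    then show ?thesis using i j tent_eq by auto
  qed
  show ?thesis using *[OF assms] *[OF assms(2,1)] commute[of x y] by linarith
qed

text \<open>W is a lower bound for the distances from the point with parameter s on edge i to the vertices;
  it extends along the edges to a 1-Lipschitz function.\<close>

lemma dist_lower: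
  assumes W: "\<And>j. j \<in> I \<Longrightarrow> \<bar>W (gam j 0) - W (gam j (l j))\<bar> \<le> l j"
    and Wi: "W (gam i 0) \<le> s" "W (gam i (l i)) \<le> l i - s"
    and st: "i \<in> I" "j \<in> I" "0 \<le> s" "s \<le> l i" "0 \<le> t" "t \<le> l j"
  shows "t + W (gam j 0) \<le> d (gam i s) (gam j t) \<or> l j - t + W (gam j (l j)) \<le> d (gam i s) (gam j t)
    \<or> (j = i \<and> \<bar>s - t\<bar> \<le> d (gam i s) (gam j t))"
proof -
  \<comment> \<open>The minimum \<open>m\<close> compares the ways through the two ends of edge k;
    on edge i the direct way competes too. The hypotheses \<open>Wi\<close> keep the direct way at
    least \<open>W\<close> at the ends, so the values at vertices stay consistent. As
    \<open>g i s\<close> is at most 0, \<open>g j t\<close> itself bounds the distance from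
    below.\<close>
  define g where "g k r = (let m = min (r + W (gam k 0)) (l k - r + W (gam k (l k)))
    in if k = i then min m \<bar>s - r\<bar> else m)" for k r
  have "g j t - g i s \<le> d (gam i s) (gam j t)"
  proof (rule lipschitz_le[where W = W])
    fix k assume k: "k \<in> I"
    note len_pos[OF k] W[OF k] Wi
    then show "g k 0 = W (gam k 0)" "g k (l k) = W (gam k (l k))"
      using st unfolding g_def by (auto simp: Let_def min_def)
  next
    fix k r q show "g k q - g k r \<le> \<bar>r - q\<bar>"
      unfolding g_def Let_def by (smt (verit, best))
  qed (use st in auto)
  moreover have "g i s \<le> 0" unfolding g_def by (auto simp: Let_def)
  ultimately have "g j t \<le> d (gam i s) (gam j t)" by linarith
  then show ?thesis unfolding g_def by (auto simp: Let_def min_def split: if_splits)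
qed

text \<open>Take \<open>W\<close> constantly equal to the distance along the edge to its nearer end:
  every way through an end is then longer than r, and only the direct way is left.\<close>

lemma ball_interior:
  assumes "i \<in> I" "0 < s" "s < l i" "j \<in> I" "0 \<le> t" "t \<le> l j" "r < min s (l i - s)"
  shows "d (gam i s) (gam j t) \<le> r \<longleftrightarrow> j = i \<and> \<bar>s - t\<bar> \<le> r"
proof -
  have "t + min s (l i - s) \<le> d (gam i s) (gam j t) \<or> l j - t + min s (l i - s) \<le> d (gam i s) (gam j t)
    \<or> (j = i \<and> \<bar>s - t\<bar> \<le> d (gam i s) (gam j t))"
    by (rule dist_lower[where W = "\<lambda>_. min s (l i - s)"]) (use assms in \<open>auto dest: len_pos\<close>)
  then show ?thesis using edge_le[of i s t] assms by auto
qed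

text \<open>The vertex v is the only one that the ball may reach; u is its distance, and \<kappa>
  bounds the distances to all other vertices from below, so that \<open>r < \<kappa>\<close> rules
  out ways through them. The bound \<open>\<kappa> \<le> u + half_min_len\<close> ensures that the
  function with value u at v and \<kappa> elsewhere changes by at most the length of each
  edge.\<close>

lemma ball_beyond:
  assumes st: "i \<in> I" "0 \<le> s" "s \<le> l i" "j \<in> I" "0 \<le> t" "t \<le> l j"
    and u: "0 \<le> u" "u \<le> \<kappa>" "\<kappa> \<le> u + half_min_len" and r: "r < \<kappa>"
    and v: "v \<in> G" "d (gam i s) v \<le> u"
    and Wi: "(if gam i 0 = v then u else \<kappa>) \<le> s" "(if gam i (l i) = v then u else \<kappa>) \<le> l i - s"
  shows "d (gam i s) (gam j t) \<le> r \<longleftrightarrow>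
    (gam j 0 = v \<and> t + u \<le> r) \<or> (gam j (l j) = v \<and> l j - t + u \<le> r) \<or> (j = i \<and> \<bar>s - t\<bar> \<le> r)"
    (is "?L \<longleftrightarrow> ?R")
proof
  let ?W = "\<lambda>q. if q = v then u else \<kappa>"
  have "t + ?W (gam j 0) \<le> d (gam i s) (gam j t) \<or> l j - t + ?W (gam j (l j)) \<le> d (gam i s) (gam j t)
    \<or> (j = i \<and> \<bar>s - t\<bar> \<le> d (gam i s) (gam j t))"
  proof (rule dist_lower)
    fix k assume "k \<in> I"
    then show "\<bar>?W (gam k 0) - ?W (gam k (l k))\<bar> \<le> l k"
      using half_min_len_le[of k] half_min_len_pos u by auto
  qed (use st Wi in auto)
  moreover assume ?L
  ultimately show ?R using r st by (smt (verit))
next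
  have G: "gam i s \<in> G" "gam j t \<in> G" using st by auto
  assume ?R
  moreover have "d (gam i s) (gam j t) \<le> u + t" if "gam j 0 = v"
    using edge_le[of j 0 t] triangle[OF G(1) v(1) G(2)] that v st by auto
  moreover have "d (gam i s) (gam j t) \<le> u + (l j - t)" if "gam j (l j) = v"
    using edge_le[of j "l j" t] triangle[OF G(1) v(1) G(2)] that v st by auto
  moreover have "d (gam i s) (gam j t) \<le> \<bar>s - t\<bar>" if "j = i" using edge_le that st by auto
  ultimately show ?L by linarith
qed

text \<open>This is the case u = 0 of \<open>ball_beyond\<close>: the centre, written as an end of
  one of its edges, is itself the vertex reached.\<close>

lemma ball_vertex:
  assumes p: "p \<in> vertices" and jt: "j \<in> I" "0 \<le> t" "t \<le> l j" and r: "r < half_min_len"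
  shows "d p (gam j t) \<le> r \<longleftrightarrow> (gam j 0 = p \<and> t \<le> r) \<or> (gam j (l j) = p \<and> l j - t \<le> r)"
proof -
  obtain i s where i: "i \<in> I" "s = 0 \<or> s = l i" "p = gam i s"
  proof -
    obtain i where "i \<in> I" "p = gam i 0 \<or> p = gam i (l i)" using p unfolding vertices_def by blast
    then show thesis using that by blast
  qed
  have m: "2 * half_min_len \<le> l i" "0 < half_min_len" "0 < l i" using i half_min_len_le half_min_len_pos len_pos by auto
  have pG: "p \<in> G" using p vertices_sub by auto
  have "d (gam i s) (gam j t) \<le> r \<longleftrightarrow>
    (gam j 0 = p \<and> t + 0 \<le> r) \<or> (gam j (l j) = p \<and> l j - t + 0 \<le> r) \<or> (j = i \<and> \<bar>s - t\<bar> \<le> r)"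
    by (rule ball_beyond[where \<kappa> = half_min_len]) (use i jt r m pG in auto)
  then show ?thesis using i jt by auto
qed

abbreviation ld :: "'a \<Rightarrow> real \<Rightarrow> real" where "ld \<equiv> local_dist G d I l gam"

text \<open>From a midpoint both ends of the edge are reached at the same radius. If their valences
  are 1 and 3, the growth rate remains 2, so the tent cannot be read off there.\<close>

definition midpoints :: "'a set" where "midpoints = (\<lambda>i. gam i (l i / 2)) ` I"

lemma tent_pos:
  assumes "x \<in> G" "x \<notin> vertices" shows "0 < tent x"
proof -
  obtain i t where "i \<in> I" "0 < t" "t < l i" "x = gam i t" using assms by (rule not_vertex_E)
  then show ?thesis using tent_eq[of i t] by auto
qed

lemma finite_midpoints: "finite midpoints"
  unfolding midpoints_def using finite_edges by simp

lemma midpoints_sub: "midpoints \<subseteq> G"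
proof
  fix x assume "x \<in> midpoints"
  then obtain i where "i \<in> I" "x = gam i (l i / 2)" unfolding midpoints_def by blast
  then show "x \<in> G" using gam_in[of i "l i / 2"] len_pos[of i] by auto
qed

section \<open>Measures of subsets of the graph\<close>

lemma gm_eq: "gm A = (\<Sum>i\<in>I. measure lborel (preim A i)) / total"
  by (simp add: graph_measure_def edge_preim_def total_def)

lemma preim_fmeasurable:
  assumes "meas A" "i \<in> I" shows "preim A i \<in> fmeasurable lborel"
proof (rule fmeasurableI2)
  show "{0..l i} \<in> fmeasurable lborel"
    using len_pos[OF assms(2)] by (simp add: fmeasurable_def)
  show "preim A i \<subseteq> {0..l i}" unfolding edge_preim_def by auto
  show "preim A i \<in> sets lborel" using assms unfolding edge_meas_def by simp
qed

lemma gm_mono: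
  assumes "meas A" "meas B" "A \<subseteq> B" shows "gm A \<le> gm B"
proof -
  have "measure lborel (preim A i) \<le> measure lborel (preim B i)" if "i \<in> I" for i
    by (rule measure_mono_fmeasurable)
      (use assms that preim_fmeasurable[of B i] preim_fmeasurable[of A i] in \<open>auto simp: edge_preim_def fmeasurableD\<close>)
  then show ?thesis unfolding gm_eq using total_pos by (simp add: divide_right_mono sum_mono)
qed

lemma gm_Un:
  assumes "meas A" "meas B" "A \<inter> B = {}"
  shows "meas (A \<union> B)" "gm (A \<union> B) = gm A + gm B"
proof -
  have pU: "preim (A \<union> B) i = preim A i \<union> preim B i" for i by (auto simp: edge_preim_def)
  show "meas (A \<union> B)" using assms(1,2) unfolding edge_meas_def pU by auto
  have "measure lborel (preim (A \<union> B) i) = measure lborel (preim A i) + measure lborel (preim B i)"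
    if "i \<in> I" for i
    unfolding pU using preim_fmeasurable[OF assms(1) that] preim_fmeasurable[OF assms(2) that] assms(3)
    by (intro measure_Union) (auto simp: edge_preim_def fmeasurable_def)
  then show "gm (A \<union> B) = gm A + gm B" unfolding gm_eq by (simp add: sum.distrib add_divide_distrib)
qed

lemma continuous_edge:
  assumes "i \<in> I" shows "continuous_map (top_of_set {0..l i}) mtopology (gam i)"
  unfolding continuous_map_to_metric
proof (intro ballI allI impI)
  fix t and e :: real assume "t \<in> topspace (top_of_set {0..l i})" and e: "0 < e"
  then have t: "0 \<le> t" "t \<le> l i" by auto
  show "\<exists>U. openin (top_of_set {0..l i}) U \<and> t \<in> U \<and> (\<forall>y\<in>U. gam i y \<in> mball (gam i t) e)"
  proof (intro exI conjI ballI)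
    show "openin (top_of_set {0..l i}) ({0..l i} \<inter> ball t e)" by (simp add: openin_open_Int)
    show "t \<in> {0..l i} \<inter> ball t e" using t e by auto
    fix y assume "y \<in> {0..l i} \<inter> ball t e"
    then show "gam i y \<in> mball (gam i t) e"
      using edge_le[OF assms t, of y] t assms gam_in by (auto simp: dist_real_def)
  qed
qed

lemma closed_meas:
  assumes "closedin mtopology C" shows "meas C"
  unfolding edge_meas_def
proof
  fix i assume i: "i \<in> I"
  have "closedin (top_of_set {0..l i}) {t \<in> topspace (top_of_set {0..l i}). gam i t \<in> C}"
    by (rule closedin_continuous_map_preimage[OF continuous_edge[OF i] assms])
  then have "closed (preim C i)"
    using closedin_closed_trans[of "{0..l i}"] by (simp add: edge_preim_def Int_def)
  then show "preim C i \<in> sets borel" by simp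
qed

lemma closedin_ball: "x \<in> G \<Longrightarrow> closedin mtopology {y \<in> G. d x y \<le> r}"
  using closedin_mcball[of x r] unfolding mcball_def by simp

lemma compactin_space: "compactin mtopology G"
proof -
  have "compactin mtopology (gam i ` {0..l i})" if "i \<in> I" for i
    by (rule image_compactin[OF _ continuous_edge[OF that]]) (simp add: compactin_subtopology)
  then show ?thesis
    using finite_edges by (subst cover) (auto intro!: compactin_Union)
qed

text \<open>A point interior to an edge has a single parameter there; any other point can only have
  the two ends as parameters.\<close>

lemma finite_preim:
  assumes "finite F" "i \<in> I" shows "finite (preim F i)"
proof -
  have "finite (preim {p} i)" for p
  proof (cases "\<exists>s. 0 < s \<and> s < l i \<and> gam i s = p")
    case True
    then obtain s where s: "0 < s" "s < l i" "gam i s = p" by auto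
    have "preim {p} i \<subseteq> {s}" unfolding edge_preim_def using s(3) sep[OF assms(2,2) s(1,2)] by fastforce
    then show ?thesis using finite_subset by blast
  next
    case False
    then have "preim {p} i \<subseteq> {0, l i}" unfolding edge_preim_def by (auto simp: less_eq_real_def)
    then show ?thesis using finite_subset by blast
  qed
  moreover have "preim F i = (\<Union>p\<in>F. preim {p} i)" unfolding edge_preim_def by auto
  ultimately show ?thesis using assms by auto
qed

lemma gm_finite: "finite F \<Longrightarrow> gm F = 0"
  unfolding gm_eq using finite_preim by (auto simp: finite_imp_null_set_lborel measure_eq_0_null_sets intro!: sum.neutral)

lemma gm_ball_pos:
  assumes y: "y \<in> G" and e: "0 < e" shows "0 < gm {z \<in> G. d y z \<le> e}"
proof -
  obtain i s where i: "i \<in> I" "0 \<le> s" "s \<le> l i" "y = gam i s" using y by (rule in_G_E)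
  let ?B = "{z \<in> G. d y z \<le> e}"
  have mB: "meas ?B" using closed_meas closedin_ball y by blast
  define a b where "a = max 0 (s - e)" and "b = min (l i) (s + e)"
  have ab: "a < b" "0 \<le> a" "b \<le> l i" using i e len_pos[OF i(1)] by (auto simp: a_def b_def)
  have "{a..b} \<subseteq> preim ?B i"
  proof
    fix t assume "t \<in> {a..b}"
    then have t: "0 \<le> t" "t \<le> l i" "\<bar>s - t\<bar> \<le> e" by (auto simp: a_def b_def)
    then show "t \<in> preim ?B i" using edge_le[OF i(1-3), of t] i gam_in by (auto simp: edge_preim_def)
  qed
  then have "measure lborel {a..b} \<le> measure lborel (preim ?B i)"
    using preim_fmeasurable[OF mB i(1)] by (intro measure_mono_fmeasurable) auto
  then have "0 < measure lborel (preim ?B i)" using ab by simp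
  also have "\<dots> \<le> (\<Sum>i\<in>I. measure lborel (preim ?B i))"
    using finite_edges i by (intro member_le_sum) auto
  finally show ?thesis unfolding gm_eq using total_pos by simp
qed

section \<open>Local distance distribution at small radii\<close>

lemma ld_eq: "ld x r = (\<Sum>j\<in>I. measure lborel {t. 0 \<le> t \<and> t \<le> l j \<and> d x (gam j t) \<le> r}) / total"
proof -
  have "preim {y \<in> G. d x y \<le> r} j = {t. 0 \<le> t \<and> t \<le> l j \<and> d x (gam j t) \<le> r}" if "j \<in> I" for j
    using that gam_in unfolding edge_preim_def by auto
  then show ?thesis unfolding local_dist_def gm_eq by (simp cong: sum.cong)
qed

lemma ld_interior:
  assumes i: "i \<in> I" "0 < s" "s < l i" and r: "0 \<le> r" "r < min s (l i - s)"
  shows "ld (gam i s) r = 2 * r / total"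
proof -
  have "measure lborel {t. 0 \<le> t \<and> t \<le> l j \<and> d (gam i s) (gam j t) \<le> r} = (if j = i then 2 * r else 0)"
    if "j \<in> I" for j
  proof -
    have "{t. 0 \<le> t \<and> t \<le> l j \<and> d (gam i s) (gam j t) \<le> r} = (if j = i then {s - r..s + r} else {})"
      using ball_interior[OF i that _ _ r(2)] r by auto
    then show ?thesis using r by simp
  qed
  then show ?thesis unfolding ld_eq using finite_edges i by (simp cong: sum.cong)
qed

lemma measure_two_ends:
  assumes "0 \<le> q" "2 * q < c"
  shows "measure lborel ((if P then {0..q} else {}) \<union> (if Q then {c - q..c} else {}))
    = ((if P then 1 else 0) + (if Q then 1 else 0)) * (q :: real)"
proof -
  have "measure lborel ({0..q} \<union> {c - q..c}) = measure lborel {0..q} + measure lborel {c - q..c}"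
    using assms by (intro measure_Union) auto
  then show ?thesis using assms by auto
qed

lemma ends_param_set:
  assumes "0 \<le> q" "2 * q < l j"
  shows "{t. 0 \<le> t \<and> t \<le> l j \<and> ((gam j 0 = p \<and> t \<le> q) \<or> (gam j (l j) = p \<and> l j - t \<le> q))}
    = (if gam j 0 = p then {0..q} else {}) \<union> (if gam j (l j) = p then {l j - q..l j} else {})"
  using assms by auto

lemma measure_ends_param:
  assumes "0 \<le> q" "2 * q < l j"
  shows "measure lborel {t. 0 \<le> t \<and> t \<le> l j \<and> ((gam j 0 = p \<and> t \<le> q) \<or> (gam j (l j) = p \<and> l j - t \<le> q))}
    = real (ends_at p j) * q"
  unfolding ends_param_set[OF assms] measure_two_ends[OF assms] ends_at_def by simp

lemma ld_vertex:
  assumes p: "p \<in> vertices" and r: "0 \<le> r" "r < half_min_len"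
  shows "ld p r = real (valence p) * r / total"
proof -
  have "measure lborel {t. 0 \<le> t \<and> t \<le> l j \<and> d p (gam j t) \<le> r} = real (ends_at p j) * r" if "j \<in> I" for j
  proof -
    have "{t. 0 \<le> t \<and> t \<le> l j \<and> d p (gam j t) \<le> r}
      = {t. 0 \<le> t \<and> t \<le> l j \<and> ((gam j 0 = p \<and> t \<le> r) \<or> (gam j (l j) = p \<and> l j - t \<le> r))}"
      using ball_vertex[OF p that _ _ r(2)] by blast
    then show ?thesis using measure_ends_param[of r j p] r half_min_len_le[OF that] by simp
  qed
  then show ?thesis unfolding ld_eq valence_def by (simp add: sum_distrib_right cong: sum.cong)
qed

text \<open>Past radius s the ball enters every edge end at the start vertex to depth
  \<open>r - s\<close>, while the bound \<open>l i / 2\<close> keeps it from reaching the far end of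
  edge i directly.\<close>

lemma ld_beyond_near_start:
  assumes i: "i \<in> I" "0 < s" "s < l i / 2" and r: "s < r" "r < min (s + half_min_len) (l i / 2)"
  shows "ld (gam i s) r = (2 * s + real (valence (gam i 0)) * (r - s)) / total"
proof -
  let ?v = "gam i 0"
  have 1: "d (gam i s) (gam j t) \<le> r \<longleftrightarrow>
    (gam j 0 = ?v \<and> t + s \<le> r) \<or> (gam j (l j) = ?v \<and> l j - t + s \<le> r) \<or> (j = i \<and> \<bar>s - t\<bar> \<le> r)"
    if "j \<in> I" "0 \<le> t" "t \<le> l j" for j t
    \<comment> \<open>The first bound in \<kappa> is the one required by \<open>ball_beyond\<close>;
      the second keeps \<kappa> below the distance \<open>l i - s\<close> to the other end of the
      edge.\<close>
    by (rule ball_beyond[where \<kappa> = "min (s + half_min_len) (l i / 2)"])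
      (use i r that half_min_len_pos edge_le[of i s 0] gam_in[of i 0] in auto)
  have "measure lborel {t. 0 \<le> t \<and> t \<le> l j \<and> d (gam i s) (gam j t) \<le> r}
    = real (ends_at ?v j) * (r - s) + (if j = i then 2 * s else 0)" if j: "j \<in> I" for j
  proof (cases "j = i")
    case False
    have "{t. 0 \<le> t \<and> t \<le> l j \<and> d (gam i s) (gam j t) \<le> r}
      = {t. 0 \<le> t \<and> t \<le> l j \<and> ((gam j 0 = ?v \<and> t \<le> r - s) \<or> (gam j (l j) = ?v \<and> l j - t \<le> r - s))}"
      using 1[OF j] False by (auto simp: algebra_simps)
    then show ?thesis using measure_ends_param[of "r - s" j ?v] r half_min_len_le[OF j] False by simp
  next
    case True
    let ?B = "if gam i (l i) = ?v then {l i - (r - s)..l i} else {}"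
    \<comment> \<open>Since \<open>s + r = 2 * s + (r - s)\<close>, the far side of the centre
      supplies the share \<open>r - s\<close> that the count assigns to the start of edge i. On a
      loop the end of the edge adds a second piece, disjoint from the first because
      \<open>r < l i / 2\<close>.\<close>
    have eq: "{t. 0 \<le> t \<and> t \<le> l j \<and> d (gam i s) (gam j t) \<le> r} = {0..s + r} \<union> ?B"
      using 1[OF j] True i r by (auto simp: algebra_simps)
    have "measure lborel ({0..s + r} \<union> ?B) = measure lborel {0..s + r} + measure lborel ?B"
      using i r by (intro measure_Union) auto
    then show ?thesis unfolding eq using True i r by (auto simp: ends_at_def algebra_simps)
  qed
  then show ?thesis unfolding ld_eq valence_def using finite_edges i
    by (simp add: sum_distrib_right sum.distrib cong: sum.cong)
qed

lemma ld_beyond_near_end: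
  assumes i: "i \<in> I" "0 < u" "u < l i / 2" and r: "u < r" "r < min (u + half_min_len) (l i / 2)"
  shows "ld (gam i (l i - u)) r = (2 * u + real (valence (gam i (l i))) * (r - u)) / total"
proof -
  let ?v = "gam i (l i)" and ?s = "l i - u"
  have 1: "d (gam i ?s) (gam j t) \<le> r \<longleftrightarrow>
    (gam j 0 = ?v \<and> t + u \<le> r) \<or> (gam j (l j) = ?v \<and> l j - t + u \<le> r) \<or> (j = i \<and> \<bar>?s - t\<bar> \<le> r)"
    if "j \<in> I" "0 \<le> t" "t \<le> l j" for j t
    by (rule ball_beyond[where \<kappa> = "min (u + half_min_len) (l i / 2)"])
      (use i r that half_min_len_pos edge_le[of i ?s "l i"] gam_in[of i "l i"] in auto)
  have "measure lborel {t. 0 \<le> t \<and> t \<le> l j \<and> d (gam i ?s) (gam j t) \<le> r}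
    = real (ends_at ?v j) * (r - u) + (if j = i then 2 * u else 0)" if j: "j \<in> I" for j
  proof (cases "j = i")
    case False
    have "{t. 0 \<le> t \<and> t \<le> l j \<and> d (gam i ?s) (gam j t) \<le> r}
      = {t. 0 \<le> t \<and> t \<le> l j \<and> ((gam j 0 = ?v \<and> t \<le> r - u) \<or> (gam j (l j) = ?v \<and> l j - t \<le> r - u))}"
      using 1[OF j] False by (auto simp: algebra_simps)
    then show ?thesis using measure_ends_param[of "r - u" j ?v] r half_min_len_le[OF j] False by simp
  next
    case True
    let ?B = "if gam i 0 = ?v then {0..r - u} else {}"
    have eq: "{t. 0 \<le> t \<and> t \<le> l j \<and> d (gam i ?s) (gam j t) \<le> r} = {?s - r..l i} \<union> ?B"
      using 1[OF j] True i r by (auto simp: algebra_simps)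
    have "measure lborel ({?s - r..l i} \<union> ?B) = measure lborel {?s - r..l i} + measure lborel ?B"
      using i r by (intro measure_Union) auto
    then show ?thesis unfolding eq using True i r by (auto simp: ends_at_def algebra_simps)
  qed
  then show ?thesis unfolding ld_eq valence_def using finite_edges i
    by (simp add: sum_distrib_right sum.distrib cong: sum.cong)
qed

lemma ld_below_tent:
  assumes "x \<in> G" "0 \<le> r" "r < tent x" shows "ld x r = 2 * r / total"
proof -
  obtain i s where i: "i \<in> I" "0 \<le> s" "s \<le> l i" "x = gam i s" using assms(1) by (rule in_G_E)
  then show ?thesis using ld_interior[of i s r] tent_eq[of i s] assms by auto
qed

text \<open>Just past the tent the ball grows at a rate given by the valence of the nearer end,
  which differs from 2; before it, \<open>ld_below_tent\<close> gives rate 2. The tent is thus the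
  radius at which the rate changes.\<close>

lemma ld_above_tent:
  assumes x: "x \<in> G" "x \<notin> vertices" "x \<notin> midpoints" and val: "\<And>p. p \<in> vertices \<Longrightarrow> valence p \<noteq> 2"
  obtains e where "0 < e" "\<And>r. \<lbrakk>tent x < r; r < tent x + e\<rbrakk> \<Longrightarrow> ld x r \<noteq> 2 * r / total"
proof -
  obtain i s where i: "i \<in> I" "0 < s" "s < l i" "x = gam i s" using x(1,2) by (rule not_vertex_E)
  have mid: "s \<noteq> l i / 2" using x(3) i(1,4) unfolding midpoints_def by blast
  let ?u = "tent x"
  have u: "?u = min s (l i - s)" using i tent_eq[of i s] by simp
  \<comment> \<open>Both growth formulas need a radius less than \<open>half_min_len\<close> past
    the tent and less than half the edge. The second condition leaves room because x is not a
    midpoint.\<close>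
  define e where "e = min half_min_len (l i / 2 - ?u)"
  have e: "0 < e" using half_min_len_pos mid u by (auto simp: e_def min_def)
  have er: "r < min (?u + half_min_len) (l i / 2)" if "r < ?u + e" for r using that by (auto simp: e_def)
  have "\<exists>p\<in>vertices. \<forall>r. ?u < r \<longrightarrow> r < ?u + e \<longrightarrow> ld x r = (2 * ?u + real (valence p) * (r - ?u)) / total"
  proof (cases "s < l i / 2")
    case True
    then have "?u = s" using u by auto
    with ld_beyond_near_start[OF i(1,2) True] er i(4) vertex_ends(1)[OF i(1)] show ?thesis
      by (intro bexI[of _ "gam i 0"]) simp_all
  next
    case False
    then have us: "l i - ?u = s" "?u < l i / 2" "0 < ?u" using u mid i by auto
    with ld_beyond_near_end[OF i(1) us(3,2)] er i(4) vertex_ends(2)[OF i(1)] show ?thesis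
      by (intro bexI[of _ "gam i (l i)"]) simp_all
  qed
  then obtain p where p: "p \<in> vertices"
    "\<And>r. \<lbrakk>?u < r; r < ?u + e\<rbrakk> \<Longrightarrow> ld x r = (2 * ?u + real (valence p) * (r - ?u)) / total" by blast
  have "ld x r \<noteq> 2 * r / total" if r: "?u < r" "r < ?u + e" for r
  proof
    assume "ld x r = 2 * r / total"
    then have "2 * ?u + real (valence p) * (r - ?u) = 2 * r" using p(2)[OF r] total_pos by simp
    then have "(real (valence p) - 2) * (r - ?u) = 0" by (simp add: algebra_simps)
    then show False using r val[OF p(1)] by simp
  qed
  then show thesis using e that by blast
qed

text \<open>Near a vertex the tent is the distance to it, near a midpoint it falls off at slope 1 on
  both sides, and elsewhere it is locally affine with slope 1 or -1. Only distances to the centre y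
  are recovered: points on different branches at a vertex may share their tent value.\<close>

lemma tent_locally_isometric:
  assumes y: "y \<in> G"
  obtains e where "0 < e" "\<And>z. \<lbrakk>z \<in> G; d y z < e\<rbrakk> \<Longrightarrow> d y z = \<bar>tent y - tent z\<bar>"
proof (cases "y \<in> vertices")
  case True
  have ty: "tent y = 0"
    using True tent_eq len_pos unfolding vertices_def by fastforce
  have "d y z = \<bar>tent y - tent z\<bar>" if z: "z \<in> G" "d y z < half_min_len" for z
  proof -
    obtain j t where j: "j \<in> I" "0 \<le> t" "t \<le> l j" "z = gam j t" using z(1) by (rule in_G_E)
    have near: "(gam j 0 = y \<and> t \<le> d y z) \<or> (gam j (l j) = y \<and> l j - t \<le> d y z)"
      using ball_vertex[OF True j(1-3) z(2)] j by auto
    have "tent z \<le> d y z" using tent_lipschitz[OF y z(1)] ty by auto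
    moreover have "d y z \<le> tent z"
      using near edge_le[of j 0 t] edge_le[of j "l j" t] j z(2) half_min_len_le[OF j(1)]
        tent_eq[OF j(1-3)] by auto
    moreover have "0 \<le> tent z" using tent_eq[OF j(1-3)] j by auto
    ultimately show ?thesis using ty by auto
  qed
  then show thesis using half_min_len_pos that by blast
next
  case False
  obtain i s where i: "i \<in> I" "0 < s" "s < l i" "y = gam i s" using y False by (rule not_vertex_E)
  \<comment> \<open>At a midpoint the whole open half edge on each side will do; otherwise the
    radius must avoid both the ends and the midpoint, where the slope changes.\<close>
  define e where "e = (if s = l i / 2 then s else min (min s (l i - s)) \<bar>s - l i / 2\<bar>)"
  have e: "0 < e" "e \<le> min s (l i - s)" using i by (auto simp: e_def)
  have "d y z = \<bar>tent y - tent z\<bar>" if z: "z \<in> G" "d y z < e" for z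
  proof -
    obtain j t where j: "j \<in> I" "0 \<le> t" "t \<le> l j" "z = gam j t" using z(1) by (rule in_G_E)
    have "d (gam i s) (gam j t) < min s (l i - s)" using z e i j by auto
    from ball_interior[OF i(1-3) j(1-3) this] have ji: "j = i" "\<bar>s - t\<bar> \<le> d y z" using i j by auto
    with edge_le[of i s t] i j have eq: "d y z = \<bar>s - t\<bar>" by auto
    then have "\<bar>s - t\<bar> < e" using z by simp
    then have "\<bar>min s (l i - s) - min t (l i - t)\<bar> = \<bar>s - t\<bar>"
      using i unfolding e_def by (auto simp: min_def abs_if split: if_splits)
    then show ?thesis using eq tent_eq[of i s] tent_eq[of i t] i j ji by simp
  qed
  then show thesis using e that by blast
qed

end

section \<open>Reversing and merging edges\<close>

lemma chain_lengths_nonneg: "c \<in> chain_lengths I l gam x y \<Longrightarrow> 0 \<le> c"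
proof -
  assume "c \<in> chain_lengths I l gam x y"
  then obtain n p b where c: "c = (\<Sum>k<n. b k)" "\<forall>k<n. b k \<in> edge_step I l gam (p k) (p (Suc k))"
    unfolding chain_lengths_def by blast
  have "0 \<le> b k" if "k < n" for k using c(2) that unfolding edge_step_def by fastforce
  then show ?thesis unfolding c(1) by (intro sum_nonneg) simp
qed

text \<open>An arc of an edge is a chain with one step, which gives \<open>edge_le\<close>. For
  \<open>universal\<close>, induction along a chain bounds e between its end points by the length of
  the chain, and passing to the infimum bounds e by \<open>d\<close>.\<close>

lemma metric_graph_imp_mgraph:
  assumes mg: "metric_graph G d I l gam" shows "mgraph G d I l gam"
proof -
  have H: "finite I" "I \<noteq> {}" "G = (\<Union>i\<in>I. gam i ` {0..l i})"
    and R: "\<forall>i\<in>I. 0 < l i" "\<forall>i\<in>I. inj_on (gam i) {0..l i}"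
      "\<forall>i\<in>I. \<forall>j\<in>I. i \<noteq> j \<longrightarrow> gam i ` {0<..<l i} \<inter> gam j ` {0..l j} = {}"
      "\<forall>x\<in>G. \<forall>y\<in>G. chain_lengths I l gam x y \<noteq> {} \<and> d x y = Inf (chain_lengths I l gam x y)"
    and M: "Metric_space G d"
    using mg[unfolded metric_graph_def] by - (elim conjE, assumption)+
  have pos: "\<And>i. i \<in> I \<Longrightarrow> 0 < l i" and inj: "\<And>i. i \<in> I \<Longrightarrow> inj_on (gam i) {0..l i}"
    and dis: "\<And>i j. \<lbrakk>i \<in> I; j \<in> I; i \<noteq> j\<rbrakk> \<Longrightarrow> gam i ` {0<..<l i} \<inter> gam j ` {0..l j} = {}"
    and dI: "\<And>x y. \<lbrakk>x \<in> G; y \<in> G\<rbrakk> \<Longrightarrow> chain_lengths I l gam x y \<noteq> {} \<and> d x y = Inf (chain_lengths I l gam x y)"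
    using R by simp_all
  interpret Metric_space G d by (rule M)
  have inG: "gam i t \<in> G" if "i \<in> I" "0 \<le> t" "t \<le> l i" for i t
    by (subst H(3), rule UN_I) (use that in auto)
  show ?thesis
  proof (unfold_locales)
    fix i j s t assume st: "i \<in> I" "j \<in> I" "0 < s" "s < l i" "0 \<le> t" "t \<le> l j" "gam i s = gam j t"
    have "i = j"
    proof (rule ccontr)
      assume "i \<noteq> j"
      moreover have "gam i s \<in> gam i ` {0<..<l i}" "gam j t \<in> gam j ` {0..l j}"
        by (rule imageI; use st in simp)+
      ultimately show False using dis[OF st(1,2)] st(7) by (metis IntI empty_iff)
    qed
    then show "i = j \<and> s = t" using inj_onD[OF inj[OF st(1)] st(7)[folded \<open>i = j\<close>]] st by auto
  next
    fix i s t assume st: "i \<in> I" "0 \<le> s" "s \<le> l i" "0 \<le> t" "t \<le> l i"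
    have "\<bar>s - t\<bar> \<in> edge_step I l gam (gam i s) (gam i t)" unfolding edge_step_def using st by auto
    then have "\<bar>s - t\<bar> \<in> chain_lengths I l gam (gam i s) (gam i t)" unfolding chain_lengths_def
      by (intro CollectI exI[of _ 1] exI[of _ "\<lambda>k. if k = 0 then gam i s else gam i t"] exI[of _ "\<lambda>_. \<bar>s - t\<bar>"]) auto
    moreover have "bdd_below (chain_lengths I l gam (gam i s) (gam i t))"
      by (rule bdd_belowI[of _ 0]) (rule chain_lengths_nonneg)
    ultimately show "d (gam i s) (gam i t) \<le> \<bar>s - t\<bar>" using dI inG st by (simp add: cInf_lower)
  next
    fix e :: "'a \<Rightarrow> 'a \<Rightarrow> real" and x y
    assume e0: "\<And>z. z \<in> G \<Longrightarrow> e z z \<le> 0"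
      and tri: "\<And>z w v. \<lbrakk>z \<in> G; w \<in> G; v \<in> G\<rbrakk> \<Longrightarrow> e z v \<le> e z w + e w v"
      and ed: "\<And>i s t. \<lbrakk>i \<in> I; 0 \<le> s; s \<le> l i; 0 \<le> t; t \<le> l i\<rbrakk> \<Longrightarrow> e (gam i s) (gam i t) \<le> \<bar>s - t\<bar>"
      and xy: "x \<in> G" "y \<in> G"
    have step: "e z w \<le> c \<and> z \<in> G \<and> w \<in> G" if "c \<in> edge_step I l gam z w" for c z w
      using that ed inG unfolding edge_step_def by auto
    have "e x (p n) \<le> (\<Sum>k<n. c k) \<and> p n \<in> G"
      if "p 0 = x" "\<forall>k<n. c k \<in> edge_step I l gam (p k) (p (Suc k))" for n p c
      using that(2)
    proof (induction n)
      case 0 then show ?case using e0 xy that by auto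
    next
      case (Suc n)
      then have "e x (p n) \<le> (\<Sum>k<n. c k)" "p n \<in> G" by auto
      moreover have "e (p n) (p (Suc n)) \<le> c n" "p (Suc n) \<in> G" using step Suc.prems by blast+
      moreover have "e x (p (Suc n)) \<le> e x (p n) + e (p n) (p (Suc n))" using tri xy calculation by auto
      ultimately show ?case by simp
    qed
    then have "e x y \<le> c" if "c \<in> chain_lengths I l gam x y" for c
      using that unfolding chain_lengths_def by blast
    then show "e x y \<le> d x y" using dI[OF xy] by (auto intro: cInf_greatest)
  qed (use H pos in \<open>assumption | blast\<close>)+
qed

section \<open>Reparametrisation and measure\<close>

lemma same_measure_refl: "same_measure I l gam I l gam"
  unfolding same_measure_def by simp

lemma same_measure_trans:
  "\<lbrakk>same_measure I l gam I' l' gam'; same_measure I' l' gam' I'' l'' gam''\<rbrakk> \<Longrightarrow> same_measure I l gam I'' l'' gam''"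
  unfolding same_measure_def by simp

lemma measure_lborel_shift:
  fixes S :: "real set" assumes S: "S \<in> sets borel"
  shows "(\<lambda>t. t - c) -` S \<in> sets borel" "measure lborel ((\<lambda>t. t - c) -` S) = measure lborel S"
proof -
  have m: "(\<lambda>t::real. t - c) \<in> borel_measurable borel" by measurable
  show "(\<lambda>t. t - c) -` S \<in> sets borel" using measurable_sets[OF m S] by simp
  have "measure lborel S = measure (distr lborel borel ((+) (- c))) S" by (simp add: lborel_distr_plus)
  also have "\<dots> = measure lborel ((\<lambda>t. t - c) -` S)"
    using S by (subst measure_distr) (auto simp: vimage_def)
  finally show "measure lborel ((\<lambda>t. t - c) -` S) = measure lborel S" by simp
qed

lemma measure_lborel_reflect:
  fixes S :: "real set" assumes S: "S \<in> sets borel"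
  shows "(\<lambda>t. c - t) -` S \<in> sets borel" "measure lborel ((\<lambda>t. c - t) -` S) = measure lborel S"
proof -
  have m: "(\<lambda>t::real. t + c) \<in> borel_measurable borel" by measurable
  have S': "(\<lambda>t. t + c) -` S \<in> sets borel" using measurable_sets[OF m S] by simp
  have eq: "(\<lambda>t. c - t) -` S = uminus -` ((\<lambda>t. t + c) -` S)" by auto
  show "(\<lambda>t. c - t) -` S \<in> sets borel"
    unfolding eq using measurable_sets[OF borel_measurable_uminus[OF measurable_ident_sets[OF refl]] S'] by simp
  have "measure lborel S = measure lborel ((\<lambda>t. t + c) -` S)" using measure_lborel_shift(2)[OF S, of "- c"] by simp
  also have "\<dots> = measure (distr lborel borel uminus) ((\<lambda>t. t + c) -` S)" by (simp add: lborel_distr_uminus)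
  also have "\<dots> = measure lborel ((\<lambda>t. c - t) -` S)"
    using S' eq by (subst measure_distr) auto
  finally show "measure lborel ((\<lambda>t. c - t) -` S) = measure lborel S" by simp
qed

text \<open>The parameter change \<open>\<sigma>\<close> is an isometric involution of each
  parameter interval, so the axioms and the measure carry over. Reversal serves to put two edges
  head to tail before they are merged.\<close>

lemma mgraph_flip:
  assumes "mgraph G d I l gam" "i \<in> I"
  defines "gam' \<equiv> gam(i := \<lambda>t. gam i (l i - t))"
  shows "mgraph G d I l gam'" "same_measure I l gam I l gam'"
proof -
  interpret mgraph G d I l gam by fact
  define \<sigma> where "\<sigma> k t = (if k = i then l i - t else t)" for k t
  have g': "gam' k t = gam k (\<sigma> k t)" and \<sigma>\<sigma>: "\<sigma> k (\<sigma> k t) = t" for k t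
    by (auto simp: gam'_def \<sigma>_def)
  have \<sigma>in: "\<lbrakk>0 \<le> t; t \<le> l k\<rbrakk> \<Longrightarrow> 0 \<le> \<sigma> k t \<and> \<sigma> k t \<le> l k" for k t by (auto simp: \<sigma>_def)
  have \<sigma>in': "\<lbrakk>0 < t; t < l k\<rbrakk> \<Longrightarrow> 0 < \<sigma> k t \<and> \<sigma> k t < l k" for k t by (auto simp: \<sigma>_def)
  have \<sigma>d: "\<bar>\<sigma> k s - \<sigma> k t\<bar> = \<bar>s - t\<bar>" for k s t by (auto simp: \<sigma>_def)
  show "mgraph G d I l gam'"
  proof (unfold_locales)
    have "gam' k ` {0..l k} = gam k ` {0..l k}" for k
    proof (intro equalityI subsetI)
      fix y assume "y \<in> gam k ` {0..l k}"
      then obtain t where "y = gam' k (\<sigma> k t)" "0 \<le> t" "t \<le> l k" using g' \<sigma>\<sigma> by auto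
      then show "y \<in> gam' k ` {0..l k}" using \<sigma>in[of t k] by auto
    next
      fix y assume "y \<in> gam' k ` {0..l k}"
      then obtain t where "y = gam k (\<sigma> k t)" "0 \<le> t" "t \<le> l k" using g' by auto
      then show "y \<in> gam k ` {0..l k}" using \<sigma>in[of t k] by auto
    qed
    then show "G = (\<Union>k\<in>I. gam' k ` {0..l k})" using cover by simp
  next
    fix a b s t assume h: "a \<in> I" "b \<in> I" "0 < s" "s < l a" "0 \<le> t" "t \<le> l b" "gam' a s = gam' b t"
    then have "a = b \<and> \<sigma> a s = \<sigma> b t"
      using sep[of a b "\<sigma> a s" "\<sigma> b t"] \<sigma>in'[of s a] \<sigma>in[of t b] g' by auto
    then show "a = b \<and> s = t" using \<sigma>\<sigma> by metis
  next
    fix k s t assume "k \<in> I" "0 \<le> s" "s \<le> l k" "0 \<le> t" "t \<le> l k"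
    then show "d (gam' k s) (gam' k t) \<le> \<bar>s - t\<bar>"
      using edge_le[of k "\<sigma> k s" "\<sigma> k t"] \<sigma>in[of s k] \<sigma>in[of t k] \<sigma>d g' by auto
  next
    fix e :: "'a \<Rightarrow> 'a \<Rightarrow> real" and x y
    assume e: "\<And>z. z \<in> G \<Longrightarrow> e z z \<le> 0"
      "\<And>z w v. \<lbrakk>z \<in> G; w \<in> G; v \<in> G\<rbrakk> \<Longrightarrow> e z v \<le> e z w + e w v"
      and ed: "\<And>i s t. \<lbrakk>i \<in> I; 0 \<le> s; s \<le> l i; 0 \<le> t; t \<le> l i\<rbrakk> \<Longrightarrow> e (gam' i s) (gam' i t) \<le> \<bar>s - t\<bar>"
      and xy: "x \<in> G" "y \<in> G"
    show "e x y \<le> d x y"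
    proof (rule universal[OF e _ xy])
      fix k s t assume "k \<in> I" "0 \<le> s" "s \<le> l k" "0 \<le> t" "t \<le> l k"
      then show "e (gam k s) (gam k t) \<le> \<bar>s - t\<bar>"
        using ed[of k "\<sigma> k s" "\<sigma> k t"] \<sigma>in[of s k] \<sigma>in[of t k] \<sigma>d g' \<sigma>\<sigma> by auto
    qed
  qed (use finite_edges edges_nonempty len_pos in auto)
  have pre: "edge_preim l gam' A k = (if k = i then (\<lambda>t. l i - t) -` preim A i else preim A k)" for A k
    by (auto simp: edge_preim_def gam'_def)
  have pre': "preim A i = (\<lambda>t. l i - t) -` edge_preim l gam' A i" for A
    by (auto simp: edge_preim_def gam'_def)
  have m: "edge_preim l gam' A k \<in> sets borel \<longleftrightarrow> preim A k \<in> sets borel" for A k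
  proof (cases "k = i")
    case True
    have "preim A i \<in> sets borel" if "edge_preim l gam' A i \<in> sets borel"
      unfolding pre' by (rule measure_lborel_reflect(1)[OF that])
    moreover have "edge_preim l gam' A i \<in> sets borel" if "preim A i \<in> sets borel"
      using measure_lborel_reflect(1)[OF that] by (simp add: pre)
    ultimately show ?thesis using True by blast
  qed (simp add: pre)
  have "measure lborel (edge_preim l gam' A k) = measure lborel (preim A k)" if "preim A k \<in> sets borel" for A k
    using measure_lborel_reflect(2)[of "preim A i" "l i"] that by (auto simp: pre)
  then show "same_measure I l gam I l gam'"
    unfolding same_measure_def edge_meas_def graph_measure_def edge_preim_def[symmetric] using m
    by (simp cong: sum.cong)
qed

text \<open>The hypotheses make p the junction of exactly two edge ends, so it can become an
  interior point. The metric is unchanged: \<open>edge_le\<close> across p is the triangle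
  inequality, and \<open>universal\<close> is inherited because a bound along the long edge contains
  the bounds along both of its parts.\<close>

lemma mgraph_merge:
  assumes "mgraph G d I l gam" and ij: "i \<in> I" "j \<in> I" "i \<noteq> j"
    and p: "gam i (l i) = p" "gam j 0 = p" "gam i 0 \<noteq> p" "gam j (l j) \<noteq> p"
    and others: "\<And>k. \<lbrakk>k \<in> I; k \<noteq> i; k \<noteq> j\<rbrakk> \<Longrightarrow> gam k 0 \<noteq> p \<and> gam k (l k) \<noteq> p"
  defines "I' \<equiv> I - {j}" and "l' \<equiv> l(i := l i + l j)"
    and "gam' \<equiv> gam(i := \<lambda>t. if t \<le> l i then gam i t else gam j (t - l i))"
  shows "mgraph G d I' l' gam'" "same_measure I l gam I' l' gam'"
proof -
  interpret mgraph G d I l gam by fact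
  have lp: "0 < l i" "0 < l j" using len_pos ij by auto
  have gi: "s \<le> l i \<Longrightarrow> gam' i s = gam i s" for s by (auto simp: gam'_def)
  have gj: "l i \<le> s \<Longrightarrow> gam' i s = gam j (s - l i)" for s using p by (auto simp: gam'_def)
  have gk: "k \<noteq> i \<Longrightarrow> gam' k = gam k" "k \<noteq> i \<Longrightarrow> l' k = l k" for k by (auto simp: gam'_def l'_def)
  have li: "l' i = l i + l j" by (simp add: l'_def)
  have I'eq: "I' = insert i (I - {i, j})" and Ieq: "I = insert i (insert j (I - {i, j}))"
    using ij by (auto simp: I'_def)
  have pG: "p \<in> G" using p ij lp gam_in[of j 0] by auto
  have pv: "p \<in> vertices" using p ij vertex_ends by auto
  \<comment> \<open>The point p has a single parameter on edge i, a single one on edge j and none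
    elsewhere. This yields \<open>sep\<close> at p, which is interior to the long edge.\<close>
  have p_i: "t = l i" if "0 \<le> t" "t \<le> l i" "gam i t = p" for t
    using vertex_param[of i t] that ij p pv by auto
  have p_j: "t = 0" if "0 \<le> t" "t \<le> l j" "gam j t = p" for t
    using vertex_param[of j t] that ij p pv by auto
  have p_k: False if "k \<in> I" "k \<noteq> i" "k \<noteq> j" "0 \<le> t" "t \<le> l k" "gam k t = p" for k t
    using vertex_param[of k t] that others pv by auto
  show "mgraph G d I' l' gam'"
  proof (unfold_locales)
    have "gam' i ` {0..l' i} = gam i ` {0..l i} \<union> gam j ` {0..l j}"
    proof (intro equalityI subsetI)
      fix y assume "y \<in> gam' i ` {0..l' i}"
      then obtain t where t: "0 \<le> t" "t \<le> l i + l j" "y = gam' i t" using li by auto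
      then show "y \<in> gam i ` {0..l i} \<union> gam j ` {0..l j}"
        using gi[of t] gj[of t] by (cases "t \<le> l i") auto
    next
      fix y assume "y \<in> gam i ` {0..l i} \<union> gam j ` {0..l j}"
      then show "y \<in> gam' i ` {0..l' i}"
      proof
        assume "y \<in> gam i ` {0..l i}"
        then obtain t where "0 \<le> t" "t \<le> l i" "y = gam i t" by auto
        then show ?thesis using gi[of t] li lp by (intro image_eqI[of _ _ t]) auto
      next
        assume "y \<in> gam j ` {0..l j}"
        then obtain t where "0 \<le> t" "t \<le> l j" "y = gam j t" by auto
        then show ?thesis using gj[of "t + l i"] li lp by (intro image_eqI[of _ _ "t + l i"]) auto
      qed
    qed
    moreover have "(\<Union>k\<in>I'. gam' k ` {0..l' k}) = gam' i ` {0..l' i} \<union> (\<Union>k\<in>I - {i, j}. gam k ` {0..l k})"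
    proof -
      have "(\<Union>k\<in>I - {i, j}. gam' k ` {0..l' k}) = (\<Union>k\<in>I - {i, j}. gam k ` {0..l k})"
        by (rule SUP_cong) (simp_all add: gk)
      then show ?thesis unfolding I'eq by simp
    qed
    moreover have "(\<Union>k\<in>I. gam k ` {0..l k}) = gam i ` {0..l i} \<union> gam j ` {0..l j} \<union> (\<Union>k\<in>I - {i, j}. gam k ` {0..l k})"
      by (subst Ieq) (simp add: Un_assoc)
    ultimately show "G = (\<Union>k\<in>I'. gam' k ` {0..l' k})" unfolding cover by simp
  next
    fix a b s t assume h: "a \<in> I'" "b \<in> I'" "0 < s" "s < l' a" "0 \<le> t" "t \<le> l' b" "gam' a s = gam' b t"
    then have ab: "a \<in> I" "b \<in> I" "a \<noteq> j" "b \<noteq> j" by (auto simp: I'_def)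
    show "a = b \<and> s = t"
    proof (cases "a = i")
      case False
      then have s: "s < l a" "gam a s = gam' b t" using h gk by auto
      show ?thesis
      proof (cases "b = i")
        case True
        then show ?thesis
          using sep[OF ab(1) ij(1) h(3) s(1), of t] sep[OF ab(1) ij(2) h(3) s(1), of "t - l i"] s h li gi[of t] gj[of t] False ab
          by (cases "t \<le> l i") auto
      next
        case False
        then show ?thesis using sep[OF ab(1,2) h(3) s(1), of t] s h gk by auto
      qed
    next
      case a: True
      \<comment> \<open>An interior parameter of the long edge is interior to one of the old edges
        or is the junction.\<close>
      consider "s < l i" | "s = l i" | "l i < s" by linarith
      then show ?thesis
      proof cases
        case 1
        then have s: "gam i s = gam' b t" using gi h a by auto
        show ?thesis
        proof (cases "b = i")
          case True
          then show ?thesis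
            using sep[OF ij(1,1) h(3) 1, of t] sep[OF ij(1,2) h(3) 1, of "t - l i"] s h li gi[of t] gj[of t] a ij
            by (cases "t \<le> l i") auto
        next
          case False
          then show ?thesis using sep[OF ij(1) ab(2) h(3) 1, of t] s h gk by auto
        qed
      next
        case 2
        then have s: "gam' b t = p" using gi h a p by auto
        show ?thesis
        proof (cases "b = i")
          case True
          then show ?thesis
            using p_i[of t] p_j[of "t - l i"] s h li gi[of t] gj[of t] a 2 by (cases "t \<le> l i") auto
        next
          case False
          then show ?thesis using p_k[of b t] s h gk ab by auto
        qed
      next
        case 3
        then have s: "gam j (s - l i) = gam' b t" "0 < s - l i" "s - l i < l j" using gj[of s] h a li by auto
        show ?thesis
        proof (cases "b = i")
          case True
          then show ?thesis
            using sep[OF ij(2,1) s(2,3), of t] sep[OF ij(2,2) s(2,3), of "t - l i"] s h li gi[of t] gj[of t] a ij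
            by (cases "t \<le> l i") auto
        next
          case False
          then show ?thesis using sep[OF ij(2) ab(2) s(2,3), of t] s h gk ab by auto
        qed
      qed
    qed
  next
    fix k s t assume h: "k \<in> I'" "0 \<le> s" "s \<le> l' k" "0 \<le> t" "t \<le> l' k"
    have *: "d (gam' i s) (gam' i t) \<le> t - s" if st: "0 \<le> s" "s \<le> t" "t \<le> l i + l j" for s t
    proof -
      consider "t \<le> l i" | "l i \<le> s" | "s < l i" "l i < t" by linarith
      then show ?thesis
      proof cases
        case 1 then show ?thesis using gi[of s] gi[of t] edge_le[OF ij(1), of s t] st by auto
      next
        case 2 then show ?thesis using gj[of s] gj[of t] edge_le[OF ij(2), of "s - l i" "t - l i"] st by auto
      next
        case 3
        have "d (gam i s) p \<le> l i - s" using edge_le[OF ij(1), of s "l i"] p 3 st lp by auto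
        moreover have "d p (gam j (t - l i)) \<le> t - l i" using edge_le[OF ij(2), of 0 "t - l i"] p 3 st lp by auto
        moreover have "d (gam i s) (gam j (t - l i)) \<le> d (gam i s) p + d p (gam j (t - l i))"
          using triangle[of "gam i s" p "gam j (t - l i)"] pG ij st 3 gam_in by auto
        ultimately show ?thesis using gi[of s] gj[of t] 3 by auto
      qed
    qed
    show "d (gam' k s) (gam' k t) \<le> \<bar>s - t\<bar>"
    proof (cases "k = i")
      case True
      then show ?thesis using *[of s t] *[of t s] h li commute[of "gam' i s" "gam' i t"] by (cases "s \<le> t") auto
    next
      case False
      then show ?thesis using edge_le[of k s t] h gk by (auto simp: I'_def)
    qed
  next
    fix e :: "'a \<Rightarrow> 'a \<Rightarrow> real" and x y
    assume e: "\<And>z. z \<in> G \<Longrightarrow> e z z \<le> 0"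
      "\<And>z w v. \<lbrakk>z \<in> G; w \<in> G; v \<in> G\<rbrakk> \<Longrightarrow> e z v \<le> e z w + e w v"
      and ed: "\<And>i s t. \<lbrakk>i \<in> I'; 0 \<le> s; s \<le> l' i; 0 \<le> t; t \<le> l' i\<rbrakk> \<Longrightarrow> e (gam' i s) (gam' i t) \<le> \<bar>s - t\<bar>"
      and xy: "x \<in> G" "y \<in> G"
    show "e x y \<le> d x y"
    proof (rule universal[OF e _ xy])
      fix k s t assume h: "k \<in> I" "0 \<le> s" "s \<le> l k" "0 \<le> t" "t \<le> l k"
      have i': "i \<in> I'" using ij by (auto simp: I'_def)
      consider "k = i" | "k = j" | "k \<noteq> i" "k \<noteq> j" by blast
      then show "e (gam k s) (gam k t) \<le> \<bar>s - t\<bar>"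
      proof cases
        case 1 then show ?thesis using ed[OF i', of s t] gi[of s] gi[of t] h li lp by auto
      next
        case 2 then show ?thesis using ed[OF i', of "s + l i" "t + l i"] gj[of "s + l i"] gj[of "t + l i"] h li lp by auto
      next
        case 3 then show ?thesis using ed[of k s t] gk h by (auto simp: I'_def)
      qed
    qed
  qed (use finite_edges edges_nonempty len_pos ij add_pos_pos[OF lp] in \<open>auto simp: I'_def l'_def\<close>)
  let ?P' = "edge_preim l' gam'"
  have pk: "?P' A k = preim A k" if "k \<noteq> i" for A k using gk[OF that] by (simp add: edge_preim_def)
  have pi: "?P' A i = preim A i \<union> (\<lambda>t. t - l i) -` preim A j" for A
  proof (intro equalityI subsetI)
    fix t assume "t \<in> ?P' A i"
    then show "t \<in> preim A i \<union> (\<lambda>t. t - l i) -` preim A j"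
      using gi[of t] gj[of t] li by (cases "t \<le> l i") (auto simp: edge_preim_def)
  next
    fix t assume "t \<in> preim A i \<union> (\<lambda>t. t - l i) -` preim A j"
    then show "t \<in> ?P' A i" using gi[of t] gj[of t] li lp by (auto simp: edge_preim_def)
  qed
  \<comment> \<open>Cutting the long edge back into its two parts recovers both old preimages, which
    gives the converse direction for measurability.\<close>
  have pi1: "preim A i = {0..l i} \<inter> ?P' A i" for A
    using gi li lp by (auto simp: edge_preim_def)
  have pi2: "preim A j = {0..l j} \<inter> (\<lambda>t. t - (- l i)) -` ?P' A i" for A
    using gj li lp by (auto simp: edge_preim_def)
  have mi: "?P' A i \<in> sets borel \<longleftrightarrow> preim A i \<in> sets borel \<and> preim A j \<in> sets borel" (is "?L \<longleftrightarrow> ?R") for A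
  proof
    assume ?L
    then show ?R using measure_lborel_shift(1)[of "?P' A i" "- l i"] pi1[of A] pi2[of A] by simp
  next
    assume ?R
    then show ?L using measure_lborel_shift(1)[of "preim A j" "l i"] unfolding pi by auto
  qed
  have mm: "edge_meas I' l' gam' A \<longleftrightarrow> meas A" for A
  proof -
    have "(\<forall>k\<in>I - {i, j}. ?P' A k \<in> sets borel) \<longleftrightarrow> (\<forall>k\<in>I - {i, j}. preim A k \<in> sets borel)"
      using pk by simp
    moreover have "meas A \<longleftrightarrow> preim A i \<in> sets borel \<and> preim A j \<in> sets borel \<and> (\<forall>k\<in>I - {i, j}. preim A k \<in> sets borel)"
      unfolding edge_meas_def by (subst Ieq) simp
    moreover have "edge_meas I' l' gam' A \<longleftrightarrow> ?P' A i \<in> sets borel \<and> (\<forall>k\<in>I - {i, j}. ?P' A k \<in> sets borel)"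
      unfolding edge_meas_def I'eq by simp
    ultimately show ?thesis using mi by simp
  qed
  have me: "measure lborel (?P' A i) = measure lborel (preim A i) + measure lborel (preim A j)" if A: "meas A" for A
  proof -
    let ?S = "(\<lambda>t. t - l i) -` preim A j"
    have Pj: "preim A j \<in> sets borel" using A ij by (auto simp: edge_meas_def)
    note S = measure_lborel_shift[OF Pj, of "l i"]
    have fS: "?S \<in> fmeasurable lborel"
    proof (rule fmeasurableI2)
      show "{l i..l i + l j} \<in> fmeasurable lborel" using lp by (simp add: fmeasurable_def)
      show "?S \<subseteq> {l i..l i + l j}" by (auto simp: edge_preim_def)
      show "?S \<in> sets lborel" using S by simp
    qed
    \<comment> \<open>The two parts overlap at most in the junction parameter, so their measures add
      up.\<close>
    have "preim A i \<inter> ?S \<subseteq> {l i}" by (auto simp: edge_preim_def)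
    then have "finite (preim A i \<inter> ?S)" using finite_subset by blast
    then have "measure lborel (preim A i \<inter> ?S) = 0"
      by (simp add: finite_imp_null_set_lborel measure_eq_0_null_sets)
    then show ?thesis unfolding pi S(2)[symmetric]
      using measure_Un3[OF preim_fmeasurable[OF A ij(1)] fS] by simp
  qed
  have split: "(\<Sum>k\<in>I. f k) = f i + f j + (\<Sum>k\<in>I - {i, j}. f k)" for f :: "nat \<Rightarrow> real"
    using finite_edges ij sum.remove[of I j f] sum.remove[of "I - {j}" i f] by (simp add: Diff_insert2[symmetric] insert_commute)
  have split': "(\<Sum>k\<in>I'. f k) = f i + (\<Sum>k\<in>I - {i, j}. f k)" for f :: "nat \<Rightarrow> real"
    using finite_edges ij sum.remove[of "I - {j}" i f] by (simp add: I'_def Diff_insert2[symmetric] insert_commute)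
  have "graph_measure I' l' gam' A = gm A" if "meas A" for A
  proof -
    have "(\<Sum>k\<in>I'. l' k) = (\<Sum>k\<in>I. l k)" unfolding split split' using li gk by (auto intro!: sum.cong)
    moreover have "(\<Sum>k\<in>I'. measure lborel (?P' A k)) = (\<Sum>k\<in>I. measure lborel (preim A k))"
      unfolding split split' me[OF that] using pk by (auto intro!: sum.cong)
    ultimately show ?thesis unfolding graph_measure_def edge_preim_def by simp
  qed
  then show "same_measure I l gam I' l' gam'" unfolding same_measure_def using mm by auto
qed

text \<open>Exactly one end of edge i lies at p, so reversing the edge exchanges the two
  possibilities; b tells whether p is wanted at the start.\<close>

lemma mgraph_orient:
  assumes M: "mgraph G d I l gam" and i: "i \<in> I" and one: "(gam i 0 = p) \<noteq> (gam i (l i) = p)"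
  obtains gam' where "mgraph G d I l gam'" "same_measure I l gam I l gam'"
    "(gam' i 0 = p) \<longleftrightarrow> b" "(gam' i (l i) = p) \<longleftrightarrow> \<not> b" "\<And>k. k \<noteq> i \<Longrightarrow> gam' k = gam k"
proof (cases "(gam i 0 = p) \<longleftrightarrow> b")
  case True
  then show thesis using that[OF M same_measure_refl] one by simp
next
  case False
  then show thesis using that[OF mgraph_flip[OF M i]] one by simp
qed

text \<open>Induction on the number of edges. The two edge ends at a vertex of valence 2 belong to
  two distinct edges or to one loop. Distinct edges are turned head to tail and merged. A loop meets
  no other edge, so it is the whole graph because distances are finite.\<close>

lemma mgraph_reduce:
  assumes "mgraph G d I l gam"
  shows "\<exists>I' l' gam'. mgraph G d I' l' gam' \<and> same_measure I l gam I' l' gam' \<and>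
    ((\<forall>p\<in>mgraph.vertices I' l' gam'. mgraph.valence I' l' gam' p \<noteq> 2) \<or> (\<exists>i. I' = {i} \<and> gam' i 0 = gam' i (l' i)))"
  using assms
proof (induction "card I" arbitrary: I l gam rule: less_induct)
  case less
  interpret mgraph G d I l gam by (rule less.prems)
  show ?case
  proof (cases "\<forall>p\<in>vertices. valence p \<noteq> 2")
    case True
    then show ?thesis
      by (intro exI[of _ I] exI[of _ l] exI[of _ gam] conjI less.prems same_measure_refl disjI1)
  next
    case False
    then obtain p where p: "p \<in> vertices" "valence p = 2" by blast
    have sumI: "(\<Sum>k\<in>I. ends_at p k) = 2" using p(2) by (simp add: valence_def)
    show ?thesis
    proof (cases "\<exists>i\<in>I. ends_at p i = 2")
      case True
      then obtain i where i: "i \<in> I" "ends_at p i = 2" by blast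
      have ip: "gam i 0 = p" "gam i (l i) = p" using i(2) by (auto simp: ends_at_def split: if_splits)
      have "(\<Sum>k\<in>I - {i}. ends_at p k) = 0" using sum.remove[OF finite_edges i(1), of "ends_at p"] sumI i(2) by simp
      then have "\<forall>k\<in>I - {i}. ends_at p k = 0" using finite_edges by simp
      then have "ends_at p k = 0" if "k \<in> I" "k \<noteq> i" for k using that by simp
      then have ks: "gam k 0 \<noteq> p" "gam k (l k) \<noteq> p" if "k \<in> I" "k \<noteq> i" for k
        using that unfolding ends_at_def by (metis add_is_0 one_neq_zero)+
      have "I = {i}"
      proof (rule ccontr)
        assume "I \<noteq> {i}"
        then obtain m where m: "m \<in> I" "m \<noteq> i" using i by blast
        \<comment> \<open>A function that is 0 on edge i and N on the rest is 1-Lipschitz for every N.\<close>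
        define N where "N = d (gam i 0) (gam m 0) + 1"
        have "(if m = i then 0 else N) - (if i = i then 0 else N) \<le> d (gam i 0) (gam m 0)"
          by (rule lipschitz_le[where W = "\<lambda>q. if q = p then 0 else N" and g = "\<lambda>k t. if k = i then 0 else N"])
            (use ip ks i m len_pos[OF i(1), THEN less_imp_le] len_pos[OF m(1), THEN less_imp_le] in auto)
        then show False using m by (simp add: N_def)
      qed
      then have "\<exists>i. I = {i} \<and> gam i 0 = gam i (l i)" using ip by simp
      then show ?thesis
        by (intro exI[of _ I] exI[of _ l] exI[of _ gam] conjI less.prems same_measure_refl disjI2)
    next
      case no2: False
      have le1: "ends_at p k = 0 \<or> ends_at p k = 1" if "k \<in> I" for k
        using no2 that by (auto simp: ends_at_def)
      have "\<not> (\<forall>k\<in>I. ends_at p k = 0)"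
      proof
        assume "\<forall>k\<in>I. ends_at p k = 0"
        then have "(\<Sum>k\<in>I. ends_at p k) = 0" by (rule sum.neutral)
        then show False using sumI by simp
      qed
      then obtain i where i: "i \<in> I" "ends_at p i = 1" using le1 by blast
      have s1: "(\<Sum>k\<in>I - {i}. ends_at p k) = 1" using sum.remove[OF finite_edges i(1), of "ends_at p"] sumI i(2) by simp
      have "\<not> (\<forall>k\<in>I - {i}. ends_at p k = 0)"
      proof
        assume "\<forall>k\<in>I - {i}. ends_at p k = 0"
        then have "(\<Sum>k\<in>I - {i}. ends_at p k) = 0" by (rule sum.neutral)
        then show False using s1 by simp
      qed
      then obtain j where j: "j \<in> I" "j \<noteq> i" "ends_at p j = 1" using le1 by blast
      have "(\<Sum>k\<in>I - {i} - {j}. ends_at p k) = 0"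
        using sum.remove[of "I - {i}" j "ends_at p"] finite_edges s1 j by simp
      then have "\<forall>k\<in>I - {i} - {j}. ends_at p k = 0" using finite_edges by simp
      then have "ends_at p k = 0" if "k \<in> I" "k \<noteq> i" "k \<noteq> j" for k using that by simp
      then have ks: "gam k 0 \<noteq> p \<and> gam k (l k) \<noteq> p" if "k \<in> I" "k \<noteq> i" "k \<noteq> j" for k
        using that unfolding ends_at_def by (metis add_is_0 one_neq_zero)
      have "(gam k 0 = p) \<noteq> (gam k (l k) = p)" if "ends_at p k = 1" for k
        using that by (cases "gam k 0 = p"; cases "gam k (l k) = p") (simp_all add: ends_at_def)
      note one = this[OF i(2)] this[OF j(3)]
      obtain g1 where g1: "mgraph G d I l g1" "same_measure I l gam I l g1"
        "g1 i 0 \<noteq> p" "g1 i (l i) = p" "\<And>k. k \<noteq> i \<Longrightarrow> g1 k = gam k"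
        by (rule mgraph_orient[OF less.prems i(1) one(1), where b = False]) simp
      have one': "(g1 j 0 = p) \<noteq> (g1 j (l j) = p)" using one(2) g1(5)[OF j(2)] by simp
      obtain g2 where g2: "mgraph G d I l g2" "same_measure I l g1 I l g2"
        "g2 j 0 = p" "g2 j (l j) \<noteq> p" "\<And>k. k \<noteq> j \<Longrightarrow> g2 k = g1 k"
        by (rule mgraph_orient[OF g1(1) j(1) one', where b = True]) simp
      have g2i: "g2 i 0 \<noteq> p" "g2 i (l i) = p" using g1(3,4) g2(5)[OF j(2)[symmetric]] by simp_all
      have g2k: "g2 k 0 \<noteq> p \<and> g2 k (l k) \<noteq> p" if "k \<in> I" "k \<noteq> i" "k \<noteq> j" for k
        using ks[OF that] g1(5)[OF that(2)] g2(5)[OF that(3)] by simp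
      define I' l' g' where "I' = I - {j}" and "l' = l(i := l i + l j)"
        and "g' = g2(i := \<lambda>t. if t \<le> l i then g2 i t else g2 j (t - l i))"
      have merge: "mgraph G d I' l' g'" "same_measure I l g2 I' l' g'"
        unfolding I'_def l'_def g'_def
        by (rule mgraph_merge[OF g2(1) i(1) j(1) j(2)[symmetric] g2i(2) g2(3) g2i(1) g2(4) g2k]; assumption)+
      have "card I' < card I" unfolding I'_def using finite_edges j(1) by (rule card_Diff1_less)
      from less.hyps[OF this merge(1)] obtain I'' l'' gam'' where
        red: "mgraph G d I'' l'' gam''" "same_measure I' l' g' I'' l'' gam''"
        "(\<forall>p\<in>mgraph.vertices I'' l'' gam''. mgraph.valence I'' l'' gam'' p \<noteq> 2) \<or> (\<exists>i. I'' = {i} \<and> gam'' i 0 = gam'' i (l'' i))"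
        by (elim exE conjE)
      have "same_measure I l gam I'' l'' gam''"
        by (rule same_measure_trans[OF same_measure_trans[OF same_measure_trans[OF g1(2) g2(2)] merge(2)] red(2)])
      then show ?thesis using red(1,3) by (intro exI conjI)
    qed
  qed
qed

section \<open>A single loop is a circle\<close>

lemma circle_dist_triangle:
  fixes a b e c :: real
  assumes "0 \<le> a" "a < c" "0 \<le> b" "b < c" "0 \<le> e" "e < c"
  shows "min \<bar>a - e\<bar> (c - \<bar>a - e\<bar>) \<le> min \<bar>a - b\<bar> (c - \<bar>a - b\<bar>) + min \<bar>b - e\<bar> (c - \<bar>b - e\<bar>)"
  using assms by (smt (verit))

text \<open>The half-open parameter interval lists every point once. The direct arc and the one
  through the base point \<open>gam i 0\<close> bound \<open>d\<close> from above; the circle metric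
  is admissible in \<open>universal\<close>, which gives the reverse bound. Measures are transported
  by \<open>same_measure\<close>, since the conclusion concerns the original edges.\<close>

lemma loop_circle_graph:
  assumes M: "mgraph G d {i} l gam" and loop: "gam i 0 = gam i (l i)"
    and sm: "same_measure I\<^sub>0 l\<^sub>0 gam\<^sub>0 {i} l gam"
  shows "circle_graph G d I\<^sub>0 l\<^sub>0 gam\<^sub>0"
proof -
  interpret mgraph G d "{i}" l gam by (rule M)
  define c where "c = l i"
  have c: "0 < c" using len_pos by (simp add: c_def)
  have loop': "gam i c = gam i 0" using loop by (simp add: c_def)
  have inj: "inj_on (gam i) {0..<c}"
  proof (rule inj_onI)
    fix s t assume "s \<in> {0..<c}" "t \<in> {0..<c}" "gam i s = gam i t"
    then show "s = t" using param_cases[of i i s t] by (auto simp: c_def)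
  qed
  have "gam i ` {0..<c} = G"
  proof (intro equalityI subsetI)
    fix x assume "x \<in> gam i ` {0..<c}" then show "x \<in> G" using gam_in[of i] by (auto simp: c_def)
  next
    fix x assume "x \<in> G"
    then obtain t where t: "0 \<le> t" "t \<le> c" "x = gam i t" by (rule in_G_E) (auto simp: c_def)
    show "x \<in> gam i ` {0..<c}"
    proof (cases "t = c")
      case True then show ?thesis using loop' t c by (intro image_eqI[of _ _ 0]) auto
    next
      case False then show ?thesis using t by (intro image_eqI[of _ _ t]) auto
    qed
  qed
  then have bij: "bij_betw (gam i) {0..<c} G" using inj by (simp add: bij_betw_def)
  define f where "f = inv_into {0..<c} (gam i)"
  have bf: "bij_betw f G {0..<c}" unfolding f_def by (rule bij_betw_inv_into[OF bij])
  have fg: "f (gam i t) = t" if "0 \<le> t" "t < c" for t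
    unfolding f_def using inv_into_f_f[OF inj] that by simp
  have fc: "f (gam i c) = 0" using fg[of 0] loop' c by simp
  have gf: "gam i (f x) = x" "0 \<le> f x" "f x < c" if "x \<in> G" for x
    using bij_betwE[OF bf] bij_betw_inv_into_right[OF bij that] that unfolding f_def by auto
  let ?e = "\<lambda>x y. min \<bar>f x - f y\<bar> (c - \<bar>f x - f y\<bar>)"
  have le: "d x y \<le> ?e x y" if xy: "x \<in> G" "y \<in> G" for x y
  proof -
    have *: "d (gam i s) (gam i t) \<le> min (t - s) (c - (t - s))" if st: "0 \<le> s" "s \<le> t" "t < c" for s t
    proof -
      have g: "gam i s \<in> G" "gam i t \<in> G" "gam i 0 \<in> G" using st c gam_in by (auto simp: c_def)
      have "d (gam i s) (gam i t) \<le> t - s" using edge_le[of i s t] st by (auto simp: c_def)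
      moreover have "d (gam i s) (gam i 0) \<le> s" using edge_le[of i s 0] st by (auto simp: c_def)
      moreover have "d (gam i 0) (gam i t) \<le> c - t" using edge_le[of i c t] st loop' c by (auto simp: c_def)
      ultimately show ?thesis using triangle[OF g(1,3,2)] by auto
    qed
    show ?thesis
    proof (cases "f x \<le> f y")
      case True then show ?thesis using *[of "f x" "f y"] gf[OF xy(1)] gf[OF xy(2)] by auto
    next
      case False then show ?thesis using *[of "f y" "f x"] gf[OF xy(1)] gf[OF xy(2)] commute[of x y] by auto
    qed
  qed
  have ge: "?e x y \<le> d x y" if xy: "x \<in> G" "y \<in> G" for x y
  proof (rule universal[of ?e, OF _ _ _ xy])
    fix z w v assume "z \<in> G" "w \<in> G" "v \<in> G"
    then show "?e z v \<le> ?e z w + ?e w v" using gf circle_dist_triangle by simp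
  next
    fix k s t assume h: "k \<in> {i}" "0 \<le> s" "s \<le> l k" "0 \<le> t" "t \<le> l k"
    then have [simp]: "k = i" by simp
    have "f (gam i r) = r \<or> (r = c \<and> f (gam i r) = 0)" if "0 \<le> r" "r \<le> c" for r
      using fg[of r] fc that by (cases "r = c") auto
    from this[of s] this[of t] h show "?e (gam k s) (gam k t) \<le> \<bar>s - t\<bar>" by (auto simp: c_def)
  qed (use c in auto)
  have "graph_measure I\<^sub>0 l\<^sub>0 gam\<^sub>0 (G \<inter> f -` A) = measure lborel A / c"
    if A: "A \<in> sets borel" "A \<subseteq> {0..<c}" for A
  proof -
    \<comment> \<open>The base point has the two parameters 0 and c, so the preimage may gain the
      single point c, which has measure 0.\<close>
    have pre: "preim (G \<inter> f -` A) i = A \<union> (if 0 \<in> A then {c} else {})"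
    proof (intro equalityI subsetI)
      fix t assume "t \<in> preim (G \<inter> f -` A) i"
      then have "0 \<le> t" "t \<le> c" "f (gam i t) \<in> A" by (auto simp: edge_preim_def c_def)
      then show "t \<in> A \<union> (if 0 \<in> A then {c} else {})" using fg[of t] fc by (cases "t = c") auto
    next
      fix t assume t: "t \<in> A \<union> (if 0 \<in> A then {c} else {})"
      then have "0 \<le> t" "t \<le> c" using A(2) c by (auto split: if_splits)
      moreover have "f (gam i t) \<in> A" using t fc fg[of t] A(2) by (auto split: if_splits)
      ultimately show "t \<in> preim (G \<inter> f -` A) i" using gam_in[of i t] by (auto simp: edge_preim_def c_def)
    qed
    have fA: "emeasure lborel A \<noteq> \<infinity>"
    proof -
      have "emeasure lborel A \<le> emeasure lborel {0..c}" using A by (intro emeasure_mono) auto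
      also have "\<dots> < \<infinity>" using c by simp
      finally show ?thesis by simp
    qed
    have "measure lborel (A \<union> {c}) = measure lborel A + measure lborel {c}"
      using A fA by (intro measure_Union) auto
    then have "measure lborel (preim (G \<inter> f -` A) i) = measure lborel A" unfolding pre by simp
    then have "gm (G \<inter> f -` A) = measure lborel A / c"
      by (simp add: graph_measure_def edge_preim_def c_def)
    moreover have "meas (G \<inter> f -` A)" unfolding edge_meas_def using pre A by simp
    ultimately show ?thesis using sm unfolding same_measure_def by simp
  qed
  then show ?thesis unfolding circle_graph_def
    using c bf le ge by (intro exI[of _ c] conjI exI[of _ f]) (auto intro: antisym)
qed

section \<open>Maps preserving the local distance distribution\<close>

text \<open>Only closed sets occur in \<open>push\<close>: balls and finite sets are all that is
  tested, and closed sets are measurable on the edges of every parametrisation, so the condition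
  survives merging.\<close>

locale mgraph_map = G: mgraph G dG IG lG gG + H: mgraph H dH IH lH gH
  for G :: "'a set" and dG IG lG gG and H :: "'b set" and dH IH lH gH +
  fixes \<phi> :: "'a \<Rightarrow> 'b"
  assumes continuous: "continuous_map G.mtopology H.mtopology \<phi>"
    and push: "\<And>B. closedin H.mtopology B \<Longrightarrow> G.gm (G \<inter> \<phi> -` B) = H.gm B"
    and ld_eq: "\<And>x r. \<lbrakk>x \<in> G; 0 \<le> r\<rbrakk> \<Longrightarrow> G.ld x r = H.ld (\<phi> x) r"
begin

section \<open>Generic points and total length\<close>

lemma phi_in: "x \<in> G \<Longrightarrow> \<phi> x \<in> H"
  using continuous_map_image_subset_topspace[OF continuous] by auto

lemma closedin_preimage: "closedin H.mtopology B \<Longrightarrow> closedin G.mtopology (G \<inter> \<phi> -` B)"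
  using closedin_continuous_map_preimage[OF continuous, of B] by (simp add: Int_def)

lemma edge_continuous:
  assumes "i \<in> IG" "0 \<le> t" "t \<le> lG i" "0 < e"
  obtains \<delta> where "0 < \<delta>"
    "\<And>t'. \<lbrakk>0 \<le> t'; t' \<le> lG i; \<bar>t' - t\<bar> < \<delta>\<rbrakk> \<Longrightarrow> dH (\<phi> (gG i t)) (\<phi> (gG i t')) < e"
proof -
  have "continuous_map (top_of_set {0..lG i}) H.mtopology (\<phi> \<circ> gG i)"
    by (rule continuous_map_compose[OF G.continuous_edge[OF assms(1)] continuous])
  from iffD1[OF H.continuous_map_to_metric this, rule_format, of t e]
  obtain U where U: "openin (top_of_set {0..lG i}) U" "t \<in> U"
    "\<forall>y\<in>U. (\<phi> \<circ> gG i) y \<in> H.mball ((\<phi> \<circ> gG i) t) e"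
    using assms by auto
  obtain T where T: "open T" "U = {0..lG i} \<inter> T" using U(1) unfolding openin_open by blast
  have "t \<in> T" using U(2) T(2) by simp
  then obtain \<delta> where "0 < \<delta>" "ball t \<delta> \<subseteq> T" using T(1) open_contains_ball by blast
  then have "dH (\<phi> (gG i t)) (\<phi> (gG i t')) < e" if "0 \<le> t'" "t' \<le> lG i" "\<bar>t' - t\<bar> < \<delta>" for t'
  proof -
    have "t' \<in> ball t \<delta>" using that by (simp add: dist_real_def)
    then have "t' \<in> U" using \<open>ball t \<delta> \<subseteq> T\<close> T(2) that by auto
    then show ?thesis using bspec[OF U(3)] by simp
  qed
  with \<open>0 < \<delta>\<close> show thesis by (rule that)
qed

text \<open>The preimage of a finite set need not be finite, as injectivity is not yet known, but by
  \<open>push\<close> it has measure 0. Together with F it cannot fill an interval of positive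
  length.\<close>

lemma edge_avoids_finite:
  assumes i: "i \<in> IG" and ab: "0 \<le> a" "a < b" "b \<le> lG i"
    and F: "finite F" "finite F'" "F' \<subseteq> H"
  obtains t where "a \<le> t" "t \<le> b" "gG i t \<notin> F" "\<phi> (gG i t) \<notin> F'"
proof (rule ccontr)
  note found = that
  assume "\<not> thesis"
  then have no: "gG i t \<in> F \<or> \<phi> (gG i t) \<in> F'" if "a \<le> t" "t \<le> b" for t using found that by blast
  have cF: "closedin H.mtopology F'"
    using F by (intro compactin_imp_closedin[OF H.Hausdorff_space_mtopology] finite_imp_compactin) auto
  let ?A = "G \<inter> \<phi> -` F'"
  have mA: "G.meas ?A" using closedin_preimage[OF cF] by (rule G.closed_meas)
  have "(\<Sum>k\<in>IG. measure lborel (G.preim ?A k)) = 0"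
    using push[OF cF] H.gm_finite[OF F(2)] G.total_pos unfolding G.gm_eq by simp
  then have zA: "measure lborel (G.preim ?A i) = 0" using G.finite_edges i by (simp add: sum_nonneg_eq_0_iff)
  have fin: "finite (G.preim F i)" using F i G.finite_preim by blast
  have fF: "G.preim F i \<in> fmeasurable lborel" and zF: "measure lborel (G.preim F i) = 0"
    using finite_imp_null_set_lborel[OF fin] by (auto simp: measure_eq_0_null_sets fmeasurable_def null_sets_def)
  have "{a..b} \<subseteq> G.preim F i \<union> G.preim ?A i"
  proof
    fix t assume "t \<in> {a..b}"
    then show "t \<in> G.preim F i \<union> G.preim ?A i"
      using no[of t] ab G.gam_in[OF i, of t] by (auto simp: edge_preim_def)
  qed
  then have "measure lborel {a..b} \<le> measure lborel (G.preim F i \<union> G.preim ?A i)"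
    using fF G.preim_fmeasurable[OF mA i] by (intro measure_mono_fmeasurable fmeasurable.Un) auto
  also have "\<dots> \<le> measure lborel (G.preim F i) + measure lborel (G.preim ?A i)"
    using fF G.preim_fmeasurable[OF mA i] by (intro measure_Un_le) auto
  finally show False using zA zF ab by simp
qed

text \<open>At a point interior to an edge whose image is also interior to one, small balls grow at
  rate 2 over the total length on both sides.\<close>

lemma total_eq: "G.total = H.total"
proof -
  obtain i where i: "i \<in> IG" using G.edges_nonempty by blast
  obtain t where t: "0 \<le> t" "t \<le> lG i" "gG i t \<notin> G.vertices" "\<phi> (gG i t) \<notin> H.vertices"
    using edge_avoids_finite[OF i, of 0 "lG i" G.vertices H.vertices] G.len_pos[OF i]
      G.finite_vertices H.finite_vertices H.vertices_sub by auto
  let ?x = "gG i t"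
  have x: "?x \<in> G" "\<phi> ?x \<in> H" using i t G.gam_in phi_in by auto
  define r where "r = min (G.tent ?x) (H.tent (\<phi> ?x)) / 2"
  have r: "0 < r" "r < G.tent ?x" "r < H.tent (\<phi> ?x)"
    using G.tent_pos[OF x(1) t(3)] H.tent_pos[OF x(2) t(4)] by (auto simp: r_def)
  have "2 * r / G.total = 2 * r / H.total"
    using G.ld_below_tent[OF x(1), of r] H.ld_below_tent[OF x(2), of r] ld_eq[OF x(1), of r] r by simp
  then show ?thesis using r G.total_pos H.total_pos by (simp add: field_simps)
qed

text \<open>In a single loop every small ball grows at rate 2, counted without the common factor
  \<open>total\<close>, whereas at a vertex of the source the rate is a valence other than 2. So
  only the source has to be assumed not to be a circle.\<close>

lemma not_loop:
  assumes val: "\<And>p. p \<in> G.vertices \<Longrightarrow> G.valence p \<noteq> 2"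
  shows "\<not> (IH = {i} \<and> gH i 0 = gH i (lH i))"
proof
  assume loop: "IH = {i} \<and> gH i 0 = gH i (lH i)"
  obtain p where p: "p \<in> G.vertices" using G.vertices_nonempty by blast
  have pG: "p \<in> G" using p G.vertices_sub by auto
  obtain e where e: "0 < e" "\<And>r. \<lbrakk>0 \<le> r; r < e\<rbrakk> \<Longrightarrow> H.ld (\<phi> p) r = 2 * r / H.total"
  proof (cases "\<phi> p \<in> H.vertices")
    case True
    have "\<phi> p = gH i 0" using True loop unfolding H.vertices_def by auto
    then have "H.valence (\<phi> p) = 2" using loop unfolding H.valence_def H.ends_at_def by simp
    then show thesis using that[OF H.half_min_len_pos] H.ld_vertex[OF True] by simp
  next
    case False
    then show thesis using that[of "H.tent (\<phi> p)"] H.tent_pos[OF phi_in[OF pG]] H.ld_below_tent[OF phi_in[OF pG]] by blast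
  qed
  define r where "r = min e G.half_min_len / 2"
  have r: "0 < r" "r < e" "r < G.half_min_len" using e(1) G.half_min_len_pos by (auto simp: r_def)
  have "real (G.valence p) * r / G.total = 2 * r / G.total"
    using G.ld_vertex[OF p, of r] e(2)[of r] ld_eq[OF pG, of r] r total_eq by simp
  then show False using val[OF p] r G.total_pos by simp
qed

end

section \<open>From equality of tents to isometry\<close>

locale reduced_mgraph_map = mgraph_map +
  assumes valG: "\<And>p. p \<in> G.vertices \<Longrightarrow> G.valence p \<noteq> 2"
    and valH: "\<And>p. p \<in> H.vertices \<Longrightarrow> H.valence p \<noteq> 2"
begin

text \<open>If the tents differed, then at radii just above the smaller one the distribution on one
  side would still be \<open>2 * r / total\<close>, while the other would already have left
  it.\<close>

lemma tent_eq_generic: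
  assumes x: "x \<in> G" "x \<notin> G.vertices" "x \<notin> G.midpoints"
    and y: "\<phi> x \<notin> H.vertices" "\<phi> x \<notin> H.midpoints"
  shows "G.tent x = H.tent (\<phi> x)"
proof -
  have yH: "\<phi> x \<in> H" using x phi_in by auto
  have pos: "0 < G.tent x" "0 < H.tent (\<phi> x)" using G.tent_pos H.tent_pos x y yH by auto
  obtain e where e: "0 < e" "\<And>r. \<lbrakk>G.tent x < r; r < G.tent x + e\<rbrakk> \<Longrightarrow> G.ld x r \<noteq> 2 * r / G.total"
    using G.ld_above_tent[OF x valG] by blast
  obtain e' where e': "0 < e'"
    "\<And>r. \<lbrakk>H.tent (\<phi> x) < r; r < H.tent (\<phi> x) + e'\<rbrakk> \<Longrightarrow> H.ld (\<phi> x) r \<noteq> 2 * r / H.total"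
    using H.ld_above_tent[OF yH y valH] by blast
  show ?thesis
  proof (rule linorder_cases[of "G.tent x" "H.tent (\<phi> x)"])
    assume lt: "G.tent x < H.tent (\<phi> x)"
    obtain r where r: "G.tent x < r" "r < min (G.tent x + e) (H.tent (\<phi> x))"
      using dense[of "G.tent x" "min (G.tent x + e) (H.tent (\<phi> x))"] lt e(1) by auto
    then show ?thesis
      using e(2)[of r] H.ld_below_tent[OF yH, of r] ld_eq[OF x(1), of r] total_eq pos by auto
  next
    assume lt: "H.tent (\<phi> x) < G.tent x"
    obtain r where r: "H.tent (\<phi> x) < r" "r < min (H.tent (\<phi> x) + e') (G.tent x)"
      using dense[of "H.tent (\<phi> x)" "min (H.tent (\<phi> x) + e') (G.tent x)"] lt e'(1) by auto
    then show ?thesis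
      using e'(2)[of r] G.ld_below_tent[OF x(1), of r] ld_eq[OF x(1), of r] total_eq pos by auto
  qed
qed

text \<open>Both sides are continuous along an edge, and generic points are dense there by
  \<open>edge_avoids_finite\<close>.\<close>

lemma tent_eq:
  assumes x: "x \<in> G" shows "G.tent x = H.tent (\<phi> x)"
proof (rule ccontr)
  assume ne: "G.tent x \<noteq> H.tent (\<phi> x)"
  define D where "D = \<bar>G.tent x - H.tent (\<phi> x)\<bar>"
  have D: "0 < D" using ne by (simp add: D_def)
  obtain i t where i: "i \<in> IG" "0 \<le> t" "t \<le> lG i" "x = gG i t" using x by (rule G.in_G_E)
  obtain \<delta> where \<delta>: "0 < \<delta>"
    "\<And>t'. \<lbrakk>0 \<le> t'; t' \<le> lG i; \<bar>t' - t\<bar> < \<delta>\<rbrakk> \<Longrightarrow> dH (\<phi> (gG i t)) (\<phi> (gG i t')) < D / 4"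
    using edge_continuous[OF i(1-3), of "D / 4"] D by auto
  \<comment> \<open>Moving to a nearby generic point changes the tent in the source by less than
    \<open>D / 4\<close>, and likewise in the target; together this cannot close the gap D.\<close>
  define \<rho> where "\<rho> = min \<delta> (D / 4) / 2"
  have \<rho>: "0 < \<rho>" "\<rho> < \<delta>" "\<rho> < D / 4" using \<delta> D by (auto simp: \<rho>_def)
  obtain t' where t': "max 0 (t - \<rho>) \<le> t'" "t' \<le> min (lG i) (t + \<rho>)"
    "gG i t' \<notin> G.vertices \<union> G.midpoints" "\<phi> (gG i t') \<notin> H.vertices \<union> H.midpoints"
    using edge_avoids_finite[OF i(1), of "max 0 (t - \<rho>)" "min (lG i) (t + \<rho>)" "G.vertices \<union> G.midpoints" "H.vertices \<union> H.midpoints"]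
      i \<rho> G.len_pos[OF i(1)] G.finite_vertices H.finite_vertices H.vertices_sub
      G.finite_midpoints H.finite_midpoints H.midpoints_sub by auto
  let ?x' = "gG i t'"
  have x': "?x' \<in> G" using t' i G.gam_in by auto
  have "\<bar>G.tent x - G.tent ?x'\<bar> \<le> \<rho>"
    using G.tent_lipschitz[OF x x'] G.edge_le[OF i(1-3), of t'] t' i by auto
  moreover have "dH (\<phi> x) (\<phi> ?x') < D / 4" using \<delta>(2)[of t'] t'(1,2) \<rho> i(4) by auto
  then have "\<bar>H.tent (\<phi> x) - H.tent (\<phi> ?x')\<bar> < D / 4"
    using H.tent_lipschitz[OF phi_in[OF x] phi_in[OF x']] by linarith
  moreover have "G.tent ?x' = H.tent (\<phi> ?x')" using tent_eq_generic x' t' by auto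
  ultimately show False using \<rho> D_def D by linarith
qed

text \<open>Near a point of the target, distances to it are differences of tents, which
  \<open>tent_eq\<close> reads off in the source, where tents are 1-Lipschitz. Bisection
  (\<open>Bolzano\<close>) passes from these local bounds to the whole interval, the bound being
  additive over adjacent intervals.\<close>

lemma edge_lipschitz:
  assumes i: "i \<in> IG" and ab: "0 \<le> a" "a \<le> b" "b \<le> lG i"
  shows "dH (\<phi> (gG i a)) (\<phi> (gG i b)) \<le> b - a"
proof -
  let ?c = "\<lambda>t. \<phi> (gG i t)"
  have cH: "?c t \<in> H" if "0 \<le> t" "t \<le> lG i" for t using phi_in G.gam_in i that by auto
  \<comment> \<open>The range conditions are premises inside P because \<open>Bolzano\<close> also
    tests intervals that stick out of the edge.\<close>
  define P where "P a b \<longleftrightarrow> (0 \<le> a \<longrightarrow> b \<le> lG i \<longrightarrow> dH (?c a) (?c b) \<le> b - a)" for a b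
  have "P a b"
  proof (rule Bolzano[OF ab(2)])
    fix a b c assume "P a b" "P b c" "a \<le> b" "b \<le> c"
    then show "P a c" unfolding P_def using H.triangle[of "?c a" "?c b" "?c c"] cH by fastforce
  next
    fix t assume "a \<le> t" "t \<le> b"
    then have t: "0 \<le> t" "t \<le> lG i" using ab by auto
    obtain e where e: "0 < e" "\<And>z. \<lbrakk>z \<in> H; dH (?c t) z < e\<rbrakk> \<Longrightarrow> dH (?c t) z = \<bar>H.tent (?c t) - H.tent z\<bar>"
      using H.tent_locally_isometric[OF cH[OF t]] by blast
    obtain \<delta> where \<delta>: "0 < \<delta>" "\<And>t'. \<lbrakk>0 \<le> t'; t' \<le> lG i; \<bar>t' - t\<bar> < \<delta>\<rbrakk> \<Longrightarrow> dH (?c t) (?c t') < e"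
      using edge_continuous[OF i t e(1)] by auto
    have near: "dH (?c t) (?c t') \<le> \<bar>t - t'\<bar>" if t': "0 \<le> t'" "t' \<le> lG i" "\<bar>t' - t\<bar> < \<delta>" for t'
    proof -
      have G': "gG i t \<in> G" "gG i t' \<in> G" using t t' i G.gam_in by auto
      have "dH (?c t) (?c t') = \<bar>G.tent (gG i t) - G.tent (gG i t')\<bar>"
        using e(2)[OF cH \<delta>(2)[OF t']] t' tent_eq[OF G'(1)] tent_eq[OF G'(2)] by simp
      also have "\<dots> \<le> \<bar>t - t'\<bar>" using G.tent_lipschitz[OF G'] G.edge_le[OF i t t'(1,2)] by simp
      finally show ?thesis .
    qed
    have "P a' b'" if "a' \<le> t" "t \<le> b'" "b' - a' < \<delta>" for a' b'
      unfolding P_def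
    proof (intro impI)
      assume "0 \<le> a'" "b' \<le> lG i"
      then show "dH (?c a') (?c b') \<le> b' - a'"
        using near[of a'] near[of b'] that t H.triangle[OF cH[of a'] cH[OF t] cH[of b']]
          H.commute[of "?c a'" "?c t"] by auto
    qed
    then show "\<exists>d>0. \<forall>a b. a \<le> t \<and> t \<le> b \<and> b - a < d \<longrightarrow> P a b" using \<delta>(1) by blast
  qed
  then show ?thesis using ab by (simp add: P_def)
qed

text \<open>The pulled-back distance satisfies the triangle inequality and is bounded by arc length,
  so \<open>universal\<close> compares it with \<open>dG\<close>.\<close>

lemma phi_lipschitz:
  assumes "x \<in> G" "y \<in> G" shows "dH (\<phi> x) (\<phi> y) \<le> dG x y"
proof (rule G.universal[where e = "\<lambda>x y. dH (\<phi> x) (\<phi> y)", OF _ _ _ assms])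
  fix i s t assume "i \<in> IG" "0 \<le> s" "s \<le> lG i" "0 \<le> t" "t \<le> lG i"
  then show "dH (\<phi> (gG i s)) (\<phi> (gG i t)) \<le> \<bar>s - t\<bar>"
    using edge_lipschitz[of i s t] edge_lipschitz[of i t s] H.commute[of "\<phi> (gG i s)" "\<phi> (gG i t)"]
    by (cases "s \<le> t") auto
qed (use phi_in H.triangle in auto)

lemma phi_isometric:
  assumes xy: "x \<in> G" "y \<in> G" shows "dH (\<phi> x) (\<phi> y) = dG x y"
proof (rule ccontr)
  assume "dH (\<phi> x) (\<phi> y) \<noteq> dG x y"
  then have lt: "dH (\<phi> x) (\<phi> y) < dG x y" using phi_lipschitz[OF xy] by simp
  \<comment> \<open>With e a third of the deficit, r exceeds the image distance by e, so the e-ball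
    around y maps into the r-ball around the image of x, yet \<open>r + e\<close> stays below
    \<open>dG x y\<close>, so the two source balls are disjoint.\<close>
  define e where "e = (dG x y - dH (\<phi> x) (\<phi> y)) / 3"
  define r where "r = dH (\<phi> x) (\<phi> y) + e"
  have e: "0 < e" "r + e < dG x y" using lt unfolding r_def e_def by (auto simp: field_simps)
  have r: "0 \<le> r" using e H.nonneg[of "\<phi> x" "\<phi> y"] by (simp add: r_def)
  let ?A = "{z \<in> G. dG x z \<le> r}" and ?E = "{z \<in> G. dG y z \<le> e}" and ?B = "{w \<in> H. dH (\<phi> x) w \<le> r}"
  have cB: "closedin H.mtopology ?B" using H.closedin_ball phi_in xy by auto
  have m: "G.meas ?A" "G.meas ?E" "G.meas (G \<inter> \<phi> -` ?B)"
    using G.closed_meas G.closedin_ball xy closedin_preimage[OF cB] by auto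
  have dis: "?A \<inter> ?E = {}"
  proof (rule ccontr)
    assume "?A \<inter> ?E \<noteq> {}"
    then obtain z where "z \<in> G" "dG x z \<le> r" "dG y z \<le> e" by auto
    then show False using G.triangle[of x z y] G.commute[of y z] xy e by auto
  qed
  have "?A \<union> ?E \<subseteq> G \<inter> \<phi> -` ?B"
  proof
    fix z assume "z \<in> ?A \<union> ?E"
    then consider "z \<in> G" "dG x z \<le> r" | "z \<in> G" "dG y z \<le> e" by auto
    then show "z \<in> G \<inter> \<phi> -` ?B"
    proof cases
      case 1 then show ?thesis using phi_lipschitz[OF xy(1), of z] phi_in by auto
    next
      case 2
      then show ?thesis
        using phi_lipschitz[OF xy(2), of z] phi_in H.triangle[of "\<phi> x" "\<phi> y" "\<phi> z"] xy by (auto simp: r_def)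
    qed
  qed
  then have "G.gm (?A \<union> ?E) \<le> G.gm (G \<inter> \<phi> -` ?B)" using G.gm_mono G.gm_Un(1)[OF m(1,2) dis] m(3) by blast
  also have "\<dots> = H.gm ?B" by (rule push[OF cB])
  also have "\<dots> = G.gm ?A" using ld_eq[OF xy(1) r] unfolding local_dist_def by simp
  finally show False using G.gm_Un(2)[OF m(1,2) dis] G.gm_ball_pos[OF xy(2) e(1)] by simp
qed

text \<open>The image is compact, hence closed. A missed point would have a ball outside the image,
  of positive measure but with empty preimage.\<close>

lemma phi_surj: "\<phi> ` G = H"
proof (rule ccontr)
  assume "\<phi> ` G \<noteq> H"
  then obtain y where y: "y \<in> H" "y \<notin> \<phi> ` G" using phi_in by blast
  have "closedin H.mtopology (\<phi> ` G)"
    by (intro compactin_imp_closedin[OF H.Hausdorff_space_mtopology] image_compactin[OF G.compactin_space continuous])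
  then have "openin H.mtopology (H - \<phi> ` G)" by (metis H.topspace_mtopology openin_closedin_eq openin_diff openin_topspace)
  then obtain e where e: "0 < e" "H.mball y e \<subseteq> H - \<phi> ` G"
    using y unfolding H.openin_mtopology by blast
  let ?B = "{w \<in> H. dH y w \<le> e / 2}"
  have "?B \<subseteq> H.mball y e" using e(1) y by auto
  then have "G \<inter> \<phi> -` ?B = {}" using e(2) by blast
  then have "H.gm ?B = 0" using push[OF H.closedin_ball[OF y(1)], of "e / 2"] G.gm_finite[of "{}"] by simp
  then show False using H.gm_ball_pos[OF y(1), of "e / 2"] e(1) by simp
qed

lemma phi_bij: "bij_betw \<phi> G H"
  unfolding bij_betw_def
proof (intro conjI inj_onI phi_surj)
  fix x y assume xy: "x \<in> G" "y \<in> G" "\<phi> x = \<phi> y"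
  then have "dG x y = 0" using phi_isometric[OF xy(1,2)] H.zero[OF phi_in[OF xy(1)] phi_in[OF xy(2)]] by simp
  then show "x = y" using G.zero[OF xy(1,2)] by simp
qed

end

section \<open>Passage to reduced edge families\<close>

lemma closedin_in_borel_sets:
  assumes "Metric_space G d" "closedin (Metric_space.mtopology G d) C"
  shows "C \<in> borel_sets G d"
proof -
  interpret Metric_space G d by fact
  have "openin mtopology (G - C)" using assms(2) by (simp add: closedin_def)
  then have "G - (G - C) \<in> borel_sets G d" unfolding borel_sets_def by (intro sigma_sets.Compl sigma_sets.Basic) simp
  moreover have "C \<subseteq> G" using closedin_subset[OF assms(2)] by simp
  ultimately show ?thesis by (simp add: double_diff)
qed

theorem theorem6p1:
  fixes G :: "'a set" and dG :: "'a \<Rightarrow> 'a \<Rightarrow> real"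
    and IG :: "nat set" and lG :: "nat \<Rightarrow> real" and gG :: "nat \<Rightarrow> real \<Rightarrow> 'a"
    and H :: "'b set" and dH :: "'b \<Rightarrow> 'b \<Rightarrow> real"
    and IH :: "nat set" and lH :: "nat \<Rightarrow> real" and gH :: "nat \<Rightarrow> real \<Rightarrow> 'b"
    and \<phi> :: "'a \<Rightarrow> 'b"
  assumes "metric_graph G dG IG lG gG"
    and "metric_graph H dH IH lH gH"
    and "\<not> circle_graph G dG IG lG gG"
    and "continuous_map (Metric_space.mtopology G dG) (Metric_space.mtopology H dH) \<phi>"
    and "\<forall>B \<in> borel_sets H dH. graph_measure IG lG gG (G \<inter> \<phi> -` B) = graph_measure IH lH gH B"
    and "\<forall>x\<in>G. \<forall>r\<ge>0. local_dist G dG IG lG gG x r = local_dist H dH IH lH gH (\<phi> x) r"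
  shows "bij_betw \<phi> G H \<and> (\<forall>x\<in>G. \<forall>y\<in>G. dH (\<phi> x) (\<phi> y) = dG x y) \<and>
         (\<forall>B \<in> borel_sets H dH. graph_measure IG lG gG (G \<inter> \<phi> -` B) = graph_measure IH lH gH B)"
proof -
  interpret G0: mgraph G dG IG lG gG by (rule metric_graph_imp_mgraph[OF assms(1)])
  interpret H0: mgraph H dH IH lH gH by (rule metric_graph_imp_mgraph[OF assms(2)])
  \<comment> \<open>Reduction changes the edges but not the metric space, so \<phi> and its
    continuity are untouched.\<close>
  obtain IG' lG' gG' where G': "mgraph G dG IG' lG' gG'" "same_measure IG lG gG IG' lG' gG'"
    and altG: "(\<forall>p\<in>mgraph.vertices IG' lG' gG'. mgraph.valence IG' lG' gG' p \<noteq> 2)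
      \<or> (\<exists>i. IG' = {i} \<and> gG' i 0 = gG' i (lG' i))"
    using mgraph_reduce[OF G0.mgraph_axioms] by blast
  obtain IH' lH' gH' where H': "mgraph H dH IH' lH' gH'" "same_measure IH lH gH IH' lH' gH'"
    and altH: "(\<forall>p\<in>mgraph.vertices IH' lH' gH'. mgraph.valence IH' lH' gH' p \<noteq> 2)
      \<or> (\<exists>i. IH' = {i} \<and> gH' i 0 = gH' i (lH' i))"
    using mgraph_reduce[OF H0.mgraph_axioms] by blast
  \<comment> \<open>The alternative of a single loop would make the source a circle graph.\<close>
  have valG: "\<forall>p\<in>mgraph.vertices IG' lG' gG'. mgraph.valence IG' lG' gG' p \<noteq> 2"
    using altG G' loop_circle_graph assms(3) by blast
  interpret G: mgraph G dG IG' lG' gG' by (rule G'(1))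
  interpret H: mgraph H dH IH' lH' gH' by (rule H'(1))
  \<comment> \<open>Closed sets suffice, as they include the balls in \<open>local_dist\<close> and
    the sets tested in \<open>push\<close>.\<close>
  have gmG: "graph_measure IG' lG' gG' A = graph_measure IG lG gG A" if "closedin G0.mtopology A" for A
    using G'(2) G0.closed_meas[OF that] unfolding same_measure_def by blast
  have gmH: "graph_measure IH' lH' gH' A = graph_measure IH lH gH A" if "closedin H0.mtopology A" for A
    using H'(2) H0.closed_meas[OF that] unfolding same_measure_def by blast
  interpret mgraph_map G dG IG' lG' gG' H dH IH' lH' gH' \<phi>
  proof
    show cont: "continuous_map G0.mtopology H0.mtopology \<phi>" by (rule assms(4))
    show "graph_measure IG' lG' gG' (G \<inter> \<phi> -` B) = graph_measure IH' lH' gH' B" if B: "closedin H0.mtopology B" for B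
    proof -
      have "closedin G0.mtopology (G \<inter> \<phi> -` B)"
        using closedin_continuous_map_preimage[OF cont B] by (simp add: Int_def)
      then show ?thesis
        using gmG gmH[OF B] assms(5) closedin_in_borel_sets[OF H0.Metric_space_axioms B] by simp
    qed
    show "local_dist G dG IG' lG' gG' x r = local_dist H dH IH' lH' gH' (\<phi> x) r" if x: "x \<in> G" and r: "0 \<le> r" for x r
    proof -
      have "\<phi> x \<in> H" using continuous_map_image_subset_topspace[OF cont] x by auto
      then show ?thesis
        using assms(6) x r gmG[OF G.closedin_ball[OF x]] gmH[OF H.closedin_ball] by (simp add: local_dist_def)
    qed
  qed
  \<comment> \<open>For the target the loop is excluded by comparison with a vertex of the reduced
    source.\<close>
  have valH: "\<forall>p\<in>H.vertices. H.valence p \<noteq> 2" using altH not_loop valG by blast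
  interpret reduced_mgraph_map G dG IG' lG' gG' H dH IH' lH' gH' \<phi>
    using valG valH by unfold_locales auto
  show ?thesis using phi_bij phi_isometric assms(5) by blast
qed

end
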